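(* Let $n\ge 2$ and let $(\alpha_m)_{m\ge 1}$ be a sequence in $(0,\pi/2)$ with $\sum_{m=1}^\infty \alpha_m^2<\infty$. Let $(u_m)_{m\ge 1}$ be a sequence in $S^{n-1}$ such that $u_{m-1}\cdot u_m=\cos\alpha_m$ for all $m\ge 2$. Then there exists a sequence of rotations $(\mathcal{R}_m)_{m\ge 1}$ of $\mathbb{R}^n$ such that for every non-empty compact set $K\subset\mathbb{R}^n$ (the rotations being independent of $K$), the rotated symmetrals $$K_m=\mathcal{R}_m\mathcal{S}_{u_m}\cdots\mathcal{S}_{u_1}K$$ converge in Hausdorff distance, as $m\to\infty$, to a compact set $L$. Moreover, $$\lim_{m\to\infty}\lambda_n(K_m\bigtriangleup L)=0 .$$
   Context: $S^{n-1}$ is the unit sphere of $\mathbb{R}^n$ and $\lambda_n$ is Lebesgue measure on $\mathbb{R}^n$; $K\bigtriangleup L$ is the symmetric difference. A rotation is an element of $SO(n)$ acting on $\mathbb{R}^n$. For $\delta>0$, $K_{(\delta)}=K+B_\delta$ denotes the outer parallel set, where $B_\delta$ is the closed ball of radius $\delta$ centered at the origin; the Hausdorff distance of compact sets $K,L$ is $d_H(K,L)=\inf\{\delta>0: K\subset L_{(\delta)}\text{ and }L\subset K_{(\delta)}\}$. Steiner symmetral: for $u\in S^{n-1}$ and $K\subset\mathbb{R}^n$ compact, $\mathcal{S}_uK$ is the compact set defined as follows. Let $u^\perp$ be the $(n-1)$-dimensional subspace orthogonal to $u$ and, for $y\in u^\perp$, let $\ell_y=y+\mathbb{R}u$. If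 $\ell_y\cap K\ne\emptyset$, then $\ell_y\cap\mathcal{S}_uK$ is the closed line segment in $\ell_y$ centered at $y$ whose length is the one-dimensional Lebesgue measure of $\ell_y\cap K$ (the single point $\{y\}$ if this measure is zero); if $\ell_y\cap K=\emptyset$, then $\ell_y\cap\mathcal{S}_uK=\emptyset$. *)

theory Defs
  imports "HOL-Analysis.Analysis" "HOL-Library.Set_Algebras"
begin

definition outer_parallel :: "real \<Rightarrow> 'a::euclidean_space set \<Rightarrow> 'a set" where
  "outer_parallel \<delta> K = K + cball 0 \<delta>"

text \<open>The infimum is taken in the reals, so this is meaningful only for non-empty bounded sets
  (otherwise the set of admissible values may be empty).\<close>

definition hausdorff_dist :: "'a::euclidean_space set \<Rightarrow> 'a set \<Rightarrow> real" where
  "hausdorff_dist K L = Inf {\<delta>. 0 < \<delta> \<and> K \<subseteq> outer_parallel \<delta> L \<and> L \<subseteq> outer_parallel \<delta> K}"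

definition line_through :: "'a::euclidean_space \<Rightarrow> 'a \<Rightarrow> 'a set" where
  "line_through u y = {y + s *\<^sub>R u |s. s \<in> UNIV}"

text \<open>For a unit vector \<open>u\<close> the map \<open>s \<mapsto> y + s u\<close> is an isometry onto the line through \<open>y\<close> in
  direction \<open>u\<close>, so the Lebesgue measure of the parameter set is the one-dimensional measure of
  the section of \<open>K\<close> by that line.\<close>

definition chord_length :: "'a::euclidean_space \<Rightarrow> 'a set \<Rightarrow> 'a \<Rightarrow> real" where
  "chord_length u K y = measure lebesgue {s. y + s *\<^sub>R u \<in> K}"

definition steiner_symmetral :: "'a::euclidean_space \<Rightarrow> 'a set \<Rightarrow> 'a set" where
  "steiner_symmetral u K =
     {y + t *\<^sub>R u |y t. y \<bullet> u = 0 \<and> line_through u y \<inter> K \<noteq> {} \<and> \<bar>t\<bar> \<le> chord_length u K y / 2}"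

text \<open>The sequence of directions is indexed from 1; its value at 0 is never used.\<close>

primrec iterated_steiner :: "(nat \<Rightarrow> 'a::euclidean_space) \<Rightarrow> nat \<Rightarrow> 'a set \<Rightarrow> 'a set" where
  "iterated_steiner u 0 K = K"
| "iterated_steiner u (Suc m) K = steiner_symmetral (u (Suc m)) (iterated_steiner u m K)"

end

(*
  Choose rotations R_m with R_m u_m = u_1 =: e, each obtained from the previous one by turning through
  the angle alpha_m in the plane of e and R_(m-1) u_m.  The rotated symmetrals then satisfy
  K_(m+1) = S_e (T K_m) with T a rotation by alpha_(m+1).  For p orthogonal to e and A >= 0 consider
  q(y + t e) = t^2 - A |y - p|^2.  A rotation by alpha shifts the chords of {q <= b} in direction e
  by O(alpha), which S_e undoes, and lengthens them only by O(alpha^2); hence max q over K_m increases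
  by at most O(alpha_(m+1)^2) in each step.  Since these errors are summable, K_m cannot come close
  to a point and later retreat from it along a subsequence: a hyperboloid {q <= b} with A large would
  separate.  This gives Hausdorff convergence to the set L of all limit points.  For the measure, S_e
  preserves volume and S_e(K) + B_d is contained in S_e(K + B_d), so the volume of K_m + B_d is at
  most that of K + B_d; thus L has volume at most that of K, and the symmetric difference vanishes
  in the limit.
*)
theory Submission
  imports Defs
begin

section \<open>Chords\<close>

text \<open>The base point \<open>x\<close> is not confined to the hyperplane orthogonal to
  \<open>u\<close>, so that membership in a symmetral can be tested at the point itself.\<close>

definition chord :: "'a::euclidean_space \<Rightarrow> 'a set \<Rightarrow> 'a \<Rightarrow> real set" where
  "chord u K x = {s. x + s *\<^sub>R u \<in> K}"

lemma chord_length_eq: "chord_length u K x = measure lebesgue (chord u K x)"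
  by (simp add: chord_length_def chord_def)

lemma chord_mono: "K \<subseteq> L \<Longrightarrow> chord u K x \<subseteq> chord u L x"
  by (auto simp: chord_def)

lemma compact_chord:
  assumes "compact K" "norm u = 1"
  shows "compact (chord u K x)"
proof -
  have "closed ((\<lambda>s. x + s *\<^sub>R u) -` K)"
    using assms by (intro continuous_closed_vimage compact_imp_closed continuous_intros)
  then have closed: "closed (chord u K x)"
    by (simp add: chord_def vimage_def)
  obtain B where B: "\<And>y. y \<in> K \<Longrightarrow> norm y \<le> B"
    using assms compact_imp_bounded bounded_iff by metis
  have "norm s \<le> B + norm x" if "s \<in> chord u K x" for s
  proof -
    have "\<bar>s\<bar> = norm ((x + s *\<^sub>R u) - x)"
      using assms by simp
    also have "\<dots> \<le> norm (x + s *\<^sub>R u) + norm x"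
      by (rule norm_triangle_ineq4)
    finally show ?thesis
      using B that by (fastforce simp: chord_def)
  qed
  then have "bounded (chord u K x)"
    by (auto simp: bounded_iff)
  with closed show ?thesis
    by (simp add: compact_eq_bounded_closed)
qed

lemma chord_lmeasurable: "compact K \<Longrightarrow> norm u = 1 \<Longrightarrow> chord u K x \<in> lmeasurable"
  by (simp add: compact_chord lmeasurable_compact)

text \<open>Moving the base point along the line only translates the parameter set, so length and
  emptiness of a chord depend on the line alone.\<close>

lemma chord_shift: "chord u K (x + r *\<^sub>R u) = (+) (- r) ` chord u K x"
proof -
  have "s \<in> (+) (- r) ` chord u K x" if "s \<in> chord u K (x + r *\<^sub>R u)" for s
    using that by (intro image_eqI[of _ _ "s + r"]) (auto simp: chord_def algebra_simps)
  then show ?thesis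
    by (auto simp: chord_def algebra_simps)
qed

lemma chord_length_shift: "chord_length u K (x + r *\<^sub>R u) = chord_length u K x"
  using measure_translation[of "- r" "chord u K x"] by (simp only: chord_length_eq chord_shift)

lemma chord_shift_empty_iff: "chord u K (x + r *\<^sub>R u) = {} \<longleftrightarrow> chord u K x = {}"
  by (simp add: chord_shift)

lemma chord_length_mono:
  assumes "compact K" "compact L" "K \<subseteq> L" "norm u = 1"
  shows "chord_length u K x \<le> chord_length u L x"
  unfolding chord_length_eq using assms
  by (intro measure_mono_fmeasurable chord_mono) (auto simp: chord_lmeasurable fmeasurableD)

section \<open>Upper semicontinuity of the chord length\<close>

lemma closed_plus_line:
  fixes u :: "'a::euclidean_space"
  assumes "compact K" "closed S" "norm u = 1"
  shows "closed {x. \<exists>s\<in>S. x + s *\<^sub>R u \<in> K}"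
proof -
  have "closed ((\<lambda>s. - s *\<^sub>R u) ` S)"
  proof (rule closed_injective_linear_image[OF \<open>closed S\<close>])
    show "linear (\<lambda>s. - s *\<^sub>R u)"
      by (auto simp: linear_iff algebra_simps)
    show "inj (\<lambda>s. - s *\<^sub>R u)"
      using assms(3) by (auto simp: inj_on_def)
  qed
  \<comment> \<open>The set in question is the Minkowski sum of the compact \<open>K\<close> and the
    closed set of all \<open>- s *\<^sub>R u\<close> with \<open>s\<close> in
    \<open>S\<close>.\<close>
  then have "closed (\<Union>x\<in>K. \<Union>y\<in>(\<lambda>s. - s *\<^sub>R u) ` S. {x + y})"
    using assms(1) by (rule compact_closed_sums[rotated])
  moreover have "(\<Union>x\<in>K. \<Union>y\<in>(\<lambda>s. - s *\<^sub>R u) ` S. {x + y}) = {x. \<exists>s\<in>S. x + s *\<^sub>R u \<in> K}"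
    by (force simp: algebra_simps)
  ultimately show ?thesis by simp
qed

text \<open>By outer regularity a chord of length below \<open>r\<close> has an open neighbourhood
  \<open>U\<close> of measure below \<open>r\<close>, and by compactness of \<open>K\<close> the
  chords of nearby base points stay in \<open>U\<close>.\<close>

lemma open_chord_length_less:
  assumes "compact K" "norm u = 1"
  shows "open {x. chord_length u K x < r}"
proof (rule open_subopen[THEN iffD2], rule ballI)
  fix x assume "x \<in> {x. chord_length u K x < r}"
  then have less: "measure lebesgue (chord u K x) < r"
    by (simp add: chord_length_eq)
  have lm: "chord u K x \<in> lmeasurable"
    using assms by (rule chord_lmeasurable)
  obtain U where U: "open U" "chord u K x \<subseteq> U" "U \<in> lmeasurable"
    "measure lebesgue U < r"
  proof -
    obtain U where U: "open U" "chord u K x \<subseteq> U" "U - chord u K x \<in> lmeasurable"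
      "emeasure lebesgue (U - chord u K x) < ennreal (r - measure lebesgue (chord u K x))"
      using sets_lebesgue_outer_open[OF fmeasurableD[OF lm]] less by (metis diff_gt_0_iff_gt)
    then have "measure lebesgue (U - chord u K x) < r - measure lebesgue (chord u K x)"
      by (simp add: emeasure_eq_measure2 ennreal_less_iff)
    moreover have "U = (U - chord u K x) \<union> chord u K x"
      using U(2) by blast
    then have "U \<in> lmeasurable"
      using U(3) lm by (metis fmeasurable.Un)
    moreover have "measure lebesgue U = measure lebesgue (U - chord u K x) + measure lebesgue (chord u K x)"
      using \<open>U = _\<close> U(3) lm by (metis Diff_disjoint inf_commute measure_Un3 diff_zero measure_empty)
    ultimately show thesis
      using that U by auto
  qed
  let ?V = "- {z. \<exists>s\<in>-U. z + s *\<^sub>R u \<in> K}"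
  have "open ?V"
    using closed_plus_line[of K "-U" u] assms U(1) by (auto simp: open_Compl)
  moreover have "x \<in> ?V"
    using U(2) by (auto simp: chord_def)
  moreover have "?V \<subseteq> {x. chord_length u K x < r}"
  proof
    fix z assume "z \<in> ?V"
    then have "chord u K z \<subseteq> U"
      by (auto simp: chord_def)
    then have "measure lebesgue (chord u K z) \<le> measure lebesgue U"
      using U(3) assms by (intro measure_mono_fmeasurable) (auto simp: chord_lmeasurable fmeasurableD)
    then show "z \<in> {x. chord_length u K x < r}"
      using U(4) by (simp add: chord_length_eq)
  qed
  ultimately show "\<exists>T. open T \<and> x \<in> T \<and> T \<subseteq> {x. chord_length u K x < r}"
    by blast
qed

section \<open>Steiner symmetrals of compact sets\<close>

text \<open>Emptiness and length of the chord may be read off at \<open>x\<close> instead of at its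
  foot in the hyperplane, and the height \<open>t\<close> of the definition becomes
  \<open>x \<bullet> u\<close>.\<close>

lemma mem_steiner_iff:
  assumes "norm u = 1"
  shows "x \<in> steiner_symmetral u K \<longleftrightarrow> chord u K x \<noteq> {} \<and> 2 * \<bar>x \<bullet> u\<bar> \<le> chord_length u K x"
proof
  assume "x \<in> steiner_symmetral u K"
  then obtain y t where x: "x = y + t *\<^sub>R u" and y: "y \<bullet> u = 0" "line_through u y \<inter> K \<noteq> {}"
    and t: "\<bar>t\<bar> \<le> chord_length u K y / 2"
    by (auto simp: steiner_symmetral_def)
  have "x \<bullet> u = t"
    using x y assms by (simp add: inner_simps norm_eq_1)
  moreover have "chord u K y \<noteq> {}"
    using y(2) by (auto simp: line_through_def chord_def)
  ultimately show "chord u K x \<noteq> {} \<and> 2 * \<bar>x \<bullet> u\<bar> \<le> chord_length u K x"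
    using t unfolding x by (simp add: chord_length_shift chord_shift_empty_iff)
next
  assume *: "chord u K x \<noteq> {} \<and> 2 * \<bar>x \<bullet> u\<bar> \<le> chord_length u K x"
  let ?y = "x + (- (x \<bullet> u)) *\<^sub>R u"
  have "x = ?y + (x \<bullet> u) *\<^sub>R u"
    by simp
  moreover have "?y \<bullet> u = 0"
    using assms by (simp add: inner_simps norm_eq_1)
  moreover have "chord u K ?y \<noteq> {}" "\<bar>x \<bullet> u\<bar> \<le> chord_length u K ?y / 2"
    using * by (simp_all only: chord_length_shift chord_shift_empty_iff) auto
  then have "line_through u ?y \<inter> K \<noteq> {}" "\<bar>x \<bullet> u\<bar> \<le> chord_length u K ?y / 2"
    by (auto simp: line_through_def chord_def)
  ultimately show "x \<in> steiner_symmetral u K"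
    unfolding steiner_symmetral_def by blast
qed

lemma steiner_mono:
  assumes "compact K" "compact L" "K \<subseteq> L" "norm u = 1"
  shows "steiner_symmetral u K \<subseteq> steiner_symmetral u L"
  using chord_mono[OF assms(3)] chord_length_mono[OF assms]
  by (force simp: mem_steiner_iff[OF assms(4)] intro: order_trans)

lemma steiner_nonempty:
  assumes "K \<noteq> {}" "norm u = 1"
  shows "steiner_symmetral u K \<noteq> {}"
proof -
  obtain x where "x \<in> K" using assms by auto
  let ?y = "x + (- (x \<bullet> u)) *\<^sub>R u"
  have "x \<bullet> u \<in> chord u K ?y"
    using \<open>x \<in> K\<close> by (simp add: chord_def)
  moreover have "?y \<bullet> u = 0"
    using assms by (simp add: inner_simps norm_eq_1)
  ultimately have "?y \<in> steiner_symmetral u K"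
    using assms by (auto simp: mem_steiner_iff chord_length_eq)
  then show ?thesis by blast
qed

text \<open>Fibres are segments centred on the hyperplane orthogonal to \<open>u\<close>; the point
  in the conclusion is \<open>x\<close> with its height \<open>x \<bullet> u\<close> replaced by
  \<open>t\<close>.\<close>

lemma steiner_fibre_convex:
  assumes "norm u = 1" "x \<in> steiner_symmetral u K" "\<bar>t\<bar> \<le> \<bar>x \<bullet> u\<bar>"
  shows "x + (t - x \<bullet> u) *\<^sub>R u \<in> steiner_symmetral u K"
  using assms unfolding mem_steiner_iff[OF assms(1)]
  by (simp add: chord_length_shift chord_shift_empty_iff inner_simps norm_eq_1)

text \<open>The centre \<open>c\<close> drops out of the conclusion: this is how symmetrization
  undoes a shift of the chords.\<close>

lemma chord_in_interval:
  assumes "chord u K x \<noteq> {}" "\<And>s. s \<in> chord u K x \<Longrightarrow> (s - c)\<^sup>2 \<le> B"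
  shows "0 \<le> B \<and> chord_length u K x \<le> 2 * sqrt B"
proof
  show "0 \<le> B"
    using assms by (metis all_not_in_conv order_trans zero_le_power2)
  have "chord u K x \<subseteq> {c - sqrt B .. c + sqrt B}"
    using assms(2) real_sqrt_le_mono by (fastforce simp: abs_le_iff)
  then have "measure lebesgue (chord u K x) \<le> measure lebesgue {c - sqrt B .. c + sqrt B}"
  \<comment> \<open>A non-measurable chord has \<open>measure\<close> 0 by convention, which makes
    the bound trivial.\<close>
  proof (cases "chord u K x \<in> sets lebesgue")
    case True
    then show ?thesis
      using \<open>chord u K x \<subseteq> _\<close> by (intro measure_mono_fmeasurable) auto
  qed (simp add: measure_notin_sets)
  then show "chord_length u K x \<le> 2 * sqrt B"
    using \<open>0 \<le> B\<close> by (simp add: chord_length_eq)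
qed

text \<open>The chord of the ball on a line in direction \<open>u\<close> is centred at the foot of
  that line. A chord of \<open>K\<close> is no longer than it, so it fits inside once
  centred.\<close>

lemma steiner_in_cball:
  assumes "K \<subseteq> cball 0 R" "norm u = 1"
  shows "steiner_symmetral u K \<subseteq> cball 0 R"
proof
  fix x assume x: "x \<in> steiner_symmetral u K"
  have K: "(norm k)\<^sup>2 \<le> R\<^sup>2" if "k \<in> K" for k
    using that assms(1) by (auto intro!: power_mono)
  have "0 \<le> R" 
  proof -
    have "K \<noteq> {}" using x by (auto simp: mem_steiner_iff[OF assms(2)] chord_def)
    then show ?thesis using assms(1) by (metis cball_empty empty_subsetI linorder_not_le subset_antisym)
  qed
  have eq: "(norm (x + s *\<^sub>R u))\<^sup>2 = (norm x)\<^sup>2 - (x \<bullet> u)\<^sup>2 + (s - (- (x \<bullet> u)))\<^sup>2" for s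
    using assms(2) unfolding power2_norm_eq_inner
    by (simp add: inner_simps norm_eq_1 inner_commute power2_eq_square algebra_simps)
  have "0 \<le> R\<^sup>2 - (norm x)\<^sup>2 + (x \<bullet> u)\<^sup>2 \<and> chord_length u K x \<le> 2 * sqrt (R\<^sup>2 - (norm x)\<^sup>2 + (x \<bullet> u)\<^sup>2)"
  proof (rule chord_in_interval)
    show "chord u K x \<noteq> {}"
      using x by (simp add: mem_steiner_iff[OF assms(2)])
    show "(s - (- (x \<bullet> u)))\<^sup>2 \<le> R\<^sup>2 - (norm x)\<^sup>2 + (x \<bullet> u)\<^sup>2" if "s \<in> chord u K x" for s
      using K[of "x + s *\<^sub>R u"] that unfolding eq by (simp add: chord_def)
  qed
  then have "\<bar>x \<bullet> u\<bar> \<le> sqrt (R\<^sup>2 - (norm x)\<^sup>2 + (x \<bullet> u)\<^sup>2)"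
    using x by (auto simp: mem_steiner_iff[OF assms(2)])
  then have "(norm x)\<^sup>2 \<le> R\<^sup>2"
    using real_le_rsqrt[of "\<bar>x \<bullet> u\<bar>"] real_le_lsqrt real_sqrt_le_iff 
    by (smt (verit) power2_abs real_sqrt_abs real_sqrt_le_iff)
  then show "x \<in> cball 0 R"
    using \<open>0 \<le> R\<close> by (simp add: power2_le_iff_abs_le)
qed

text \<open>The lines meeting \<open>K\<close> fill a closed set, and the condition on the height is
  closed because the chord length is upper semicontinuous.\<close>

lemma compact_steiner:
  assumes "compact K" "norm u = 1"
  shows "compact (steiner_symmetral u K)"
proof -
  obtain R where "K \<subseteq> cball 0 R"
    using compact_imp_bounded[OF assms(1)] unfolding bounded_iff by force
  then have "bounded (steiner_symmetral u K)"
    using bounded_subset[OF bounded_cball steiner_in_cball[OF _ assms(2)]] by blast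
  moreover have "closed {x. chord u K x \<noteq> {}}"
    using closed_plus_line[of K UNIV u] assms by (simp add: chord_def)
  moreover have "open {x. chord_length u K x < 2 * \<bar>x \<bullet> u\<bar>}"
  proof -
    \<comment> \<open>An intermediate \<open>r\<close> separates the two sides of the strict
      inequality, which reduces it to open sublevel sets of the chord length.\<close>
    have "{x. chord_length u K x < 2 * \<bar>x \<bullet> u\<bar>} = (\<Union>r. {x. chord_length u K x < r} \<inter> {x. r < 2 * \<bar>x \<bullet> u\<bar>})"
    proof (intro equalityI subsetI)
      fix x assume "x \<in> {x. chord_length u K x < 2 * \<bar>x \<bullet> u\<bar>}"
      then obtain r where "chord_length u K x < r" "r < 2 * \<bar>x \<bullet> u\<bar>"
        using dense by blast
      then show "x \<in> (\<Union>r. {x. chord_length u K x < r} \<inter> {x. r < 2 * \<bar>x \<bullet> u\<bar>})"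
        by blast
    qed auto
    moreover have "open {x. r < 2 * \<bar>x \<bullet> u\<bar>}" for r
      by (intro open_Collect_less continuous_intros)
    ultimately show ?thesis
      by (simp only:) (intro open_UN open_Int ballI open_chord_length_less[OF assms])
  qed
  then have "closed {x. 2 * \<bar>x \<bullet> u\<bar> \<le> chord_length u K x}"
    by (simp add: closed_def Compl_eq not_le)
  moreover have "steiner_symmetral u K = {x. chord u K x \<noteq> {}} \<inter> {x. 2 * \<bar>x \<bullet> u\<bar> \<le> chord_length u K x}"
    by (auto simp: mem_steiner_iff[OF assms(2)])
  ultimately show ?thesis
    by (simp add: compact_eq_bounded_closed closed_Int)
qed

section \<open>Equivariance under orthogonal maps\<close>

lemma chord_image_orthogonal:
  fixes f :: "'a::euclidean_space \<Rightarrow> 'a"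
  assumes "orthogonal_transformation f"
  shows "chord (f u) (f ` K) (f x) = chord u K x"
proof -
  have "f x + s *\<^sub>R f u = f (x + s *\<^sub>R u)" for s
    using assms by (simp add: orthogonal_transformation_def linear_add linear_scale)
  then show ?thesis
    using orthogonal_transformation_inj[OF assms] by (simp add: chord_def inj_image_mem_iff)
qed

text \<open>Orthogonal maps preserve chords and heights. This lets a rotation applied after a
  symmetrization be moved inside it, at the price of rotating the direction.\<close>

lemma steiner_image_orthogonal:
  fixes f :: "'a::euclidean_space \<Rightarrow> 'a"
  assumes "orthogonal_transformation f" "norm u = 1"
  shows "f ` steiner_symmetral u K = steiner_symmetral (f u) (f ` K)"
proof -
  have nfu: "norm (f u) = 1"
    using assms by (simp add: orthogonal_transformation_norm)
  have "f x \<in> steiner_symmetral (f u) (f ` K) \<longleftrightarrow> x \<in> steiner_symmetral u K" for x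
    using assms nfu
    by (simp add: mem_steiner_iff chord_image_orthogonal chord_length_eq orthogonal_transformation_def)
  then show ?thesis
    using orthogonal_transformation_surj[OF assms(1)] by (auto simp: surj_def image_iff) metis
qed

section \<open>Outer parallel sets\<close>

lemma mem_outer_parallel: "x \<in> outer_parallel \<delta> K \<longleftrightarrow> (\<exists>k\<in>K. dist k x \<le> \<delta>)"
proof
  assume "x \<in> outer_parallel \<delta> K"
  then show "\<exists>k\<in>K. dist k x \<le> \<delta>"
    by (force simp: outer_parallel_def set_plus_def dist_norm)
next
  assume "\<exists>k\<in>K. dist k x \<le> \<delta>"
  then obtain k where k: "k \<in> K" "dist k x \<le> \<delta>" by blast
  moreover have "x = k + (x - k)" "x - k \<in> cball 0 \<delta>"
    using k by (auto simp: dist_norm norm_minus_commute)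
  ultimately show "x \<in> outer_parallel \<delta> K"
    unfolding outer_parallel_def by (metis set_plus_intro)
qed

lemma compact_outer_parallel:
  assumes "compact K"
  shows "compact (outer_parallel \<delta> K)"
proof -
  have "outer_parallel \<delta> K = {x + y |x y. x \<in> K \<and> y \<in> cball 0 \<delta>}"
    unfolding outer_parallel_def set_plus_def by blast
  then show ?thesis
    using compact_sums[OF assms compact_cball[of 0 \<delta>]] by simp
qed

lemma outer_parallel_mono_radius: "\<delta> \<le> \<epsilon> \<Longrightarrow> outer_parallel \<delta> K \<subseteq> outer_parallel \<epsilon> K"
  by (force simp: mem_outer_parallel)

lemma outer_parallel_superset: "0 \<le> \<delta> \<Longrightarrow> K \<subseteq> outer_parallel \<delta> K"
  by (force simp: mem_outer_parallel)

lemma outer_parallel_image_orthogonal: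
  fixes f :: "'a::euclidean_space \<Rightarrow> 'a"
  assumes "orthogonal_transformation f"
  shows "outer_parallel \<delta> (f ` K) = f ` outer_parallel \<delta> K"
proof -
  have "f x \<in> outer_parallel \<delta> (f ` K) \<longleftrightarrow> x \<in> outer_parallel \<delta> K" for x
    using assms by (simp add: mem_outer_parallel orthogonal_transformation_isometry)
  then show ?thesis
    using orthogonal_transformation_surj[OF assms(1)] by (auto simp: surj_def image_iff) metis
qed

section \<open>Symmetrization and parallel sets\<close>

lemma measure_thickening_ge:
  fixes I J :: "real set"
  assumes "compact I" "I \<noteq> {}" "J \<in> lmeasurable" "0 \<le> r"
    and thick: "\<And>s \<rho>. s \<in> I \<Longrightarrow> \<bar>\<rho>\<bar> \<le> r \<Longrightarrow> s + \<rho> \<in> J"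
  shows "measure lebesgue I + 2 * r \<le> measure lebesgue J"
proof -
  obtain M where M: "M \<in> I" "\<And>s. s \<in> I \<Longrightarrow> s \<le> M"
    using compact_attains_sup[OF assms(1,2)] by blast
  \<comment> \<open>\<open>I\<close> shifted left by \<open>r\<close> ends at \<open>M - r\<close>,
    where the open interval of length \<open>2 * r\<close> around the maximum \<open>M\<close>
    begins; these are disjoint parts of \<open>J\<close>.\<close>
  let ?I = "(+) (- r) ` I" and ?E = "{M - r <..< M + r}"
  have lm: "?I \<in> lmeasurable"
    using assms(1) by (intro lmeasurable_compact compact_translation)
  have "?I \<inter> ?E = {}"
    using M(2) by force
  then have "measure lebesgue (?I \<union> ?E) = measure lebesgue ?I + measure lebesgue ?E"
    using lm by (simp add: measure_Un3 lmeasurable_interval)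
  moreover have "?I \<union> ?E \<subseteq> J"
  proof
    fix x assume "x \<in> ?I \<union> ?E"
    then consider s where "s \<in> I" "x = s + (- r)" | "\<bar>x - M\<bar> \<le> r"
      by force
    then show "x \<in> J"
      using thick[of _ "- r"] thick[of M "x - M"] M(1) \<open>0 \<le> r\<close> by cases auto
  qed
  then have "measure lebesgue (?I \<union> ?E) \<le> measure lebesgue J"
    using lm assms(3) by (intro measure_mono_fmeasurable) (auto simp: fmeasurableD)
  moreover have "measure lebesgue ?E = 2 * r"
    using \<open>0 \<le> r\<close> by simp
  ultimately show ?thesis
    using measure_translation[of "- r" I] by linarith
qed

text \<open>Split the displacement from \<open>x\<close> to \<open>x'\<close> into \<open>w\<close>
  orthogonal to \<open>u\<close> and \<open>r\<close> along \<open>u\<close>. Inside the parallel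
  set every point of the chord through \<open>x\<close> may be moved by \<open>w\<close> and by up
  to \<open>\<bar>r\<bar>\<close> along \<open>u\<close>, so the chord gains length at least
  \<open>2 * \<bar>r\<bar>\<close>, while the height gains at most
  \<open>\<bar>r\<bar>\<close>.\<close>

lemma steiner_outer_parallel_subset:
  assumes "compact K" "norm u = 1"
  shows "outer_parallel \<delta> (steiner_symmetral u K) \<subseteq> steiner_symmetral u (outer_parallel \<delta> K)"
proof
  fix x' assume "x' \<in> outer_parallel \<delta> (steiner_symmetral u K)"
  then obtain x where x: "x \<in> steiner_symmetral u K" and "dist x x' \<le> \<delta>"
    by (auto simp: mem_outer_parallel)
  define r where "r = (x' - x) \<bullet> u"
  define w where "w = x' - x - r *\<^sub>R u"
  have x': "x' = (x + w) + r *\<^sub>R u"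
    by (simp add: w_def)
  have uu: "u \<bullet> u = 1" using assms by (simp add: norm_eq_1)
  have wu: "w \<bullet> u = 0" "u \<bullet> w = 0"
    using uu by (auto simp: w_def r_def inner_simps inner_commute)
  have nw: "(norm (w + \<rho> *\<^sub>R u))\<^sup>2 = (norm w)\<^sup>2 + \<rho>\<^sup>2" for \<rho>
    unfolding power2_norm_eq_inner using wu uu by (simp add: inner_simps power2_eq_square)
  have "w + r *\<^sub>R u = x' - x" by (simp add: w_def)
  then have norm_r: "norm (w + r *\<^sub>R u) \<le> \<delta>"
    using \<open>dist x x' \<le> \<delta>\<close> by (simp add: dist_norm norm_minus_commute)
  have thick: "s + \<rho> \<in> chord u (outer_parallel \<delta> K) (x + w)"
    if "s \<in> chord u K x" "\<bar>\<rho>\<bar> \<le> \<bar>r\<bar>" for s \<rho>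
  proof -
    have "(norm (w + \<rho> *\<^sub>R u))\<^sup>2 \<le> (norm (w + r *\<^sub>R u))\<^sup>2"
      using that(2) unfolding nw by (simp add: abs_le_square_iff)
    then have "norm (w + \<rho> *\<^sub>R u) \<le> \<delta>"
      using norm_r by (meson norm_ge_zero order_trans power2_le_imp_le)
    then have "dist (x + s *\<^sub>R u) (x + w + (s + \<rho>) *\<^sub>R u) \<le> \<delta>"
      by (subst dist_commute) (simp add: dist_norm algebra_simps)
    then show ?thesis
      using that(1) by (auto simp: chord_def mem_outer_parallel)
  qed
  have ne: "chord u K x \<noteq> {}" and le: "2 * \<bar>x \<bullet> u\<bar> \<le> chord_length u K x"
    using x by (auto simp: mem_steiner_iff[OF assms(2)])
  have "chord_length u K x + 2 * \<bar>r\<bar> \<le> chord_length u (outer_parallel \<delta> K) (x + w)"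
    unfolding chord_length_eq using assms thick ne
    by (intro measure_thickening_ge) (auto simp: compact_chord chord_lmeasurable compact_outer_parallel)
  moreover have "x' \<bullet> u = x \<bullet> u + r"
    using wu uu by (simp add: x' inner_simps)
  ultimately have "2 * \<bar>x' \<bullet> u\<bar> \<le> chord_length u (outer_parallel \<delta> K) x'"
    using le unfolding x' chord_length_shift by linarith
  moreover have "chord u (outer_parallel \<delta> K) x' \<noteq> {}"
    using ne thick[of _ 0] unfolding x' chord_shift_empty_iff by fastforce
  ultimately show "x' \<in> steiner_symmetral u (outer_parallel \<delta> K)"
    by (simp add: mem_steiner_iff[OF assms(2)])
qed

section \<open>Volume of parallel sets for small radii\<close>

lemma Inter_outer_parallel:
  assumes "closed K"
  shows "(\<Inter>n. outer_parallel (inverse (real (Suc n))) K) = K"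
proof (rule subset_antisym)
  show "K \<subseteq> (\<Inter>n. outer_parallel (inverse (real (Suc n))) K)"
  proof (rule INT_greatest)
    show "K \<subseteq> outer_parallel (inverse (real (Suc n))) K" for n
      by (rule outer_parallel_superset) simp
  qed
  show "(\<Inter>n. outer_parallel (inverse (real (Suc n))) K) \<subseteq> K"
  proof
    fix x assume x: "x \<in> (\<Inter>n. outer_parallel (inverse (real (Suc n))) K)"
    have "\<exists>k\<in>K. dist k x < e" if "e > 0" for e
    proof -
      obtain n where n: "inverse (real (Suc n)) < e"
        using reals_Archimedean \<open>e > 0\<close> by blast
      have "x \<in> outer_parallel (inverse (real (Suc n))) K"
        using x by blast
      then obtain k where "k \<in> K" "dist k x \<le> inverse (real (Suc n))"
        unfolding mem_outer_parallel by (elim bexE)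
      then show ?thesis
        using n by (intro bexI[of _ k]) linarith+
    qed
    then have "x \<in> closure K"
      by (simp add: closure_approachable)
    then show "x \<in> K"
      using assms by simp
  qed
qed

lemma measure_outer_parallel_tendsto:
  fixes K :: "'a::euclidean_space set"
  assumes "compact K"
  shows "(\<lambda>n. measure lebesgue (outer_parallel (inverse (real (Suc n))) K)) \<longlonglongrightarrow> measure lebesgue K"
proof -
  let ?P = "\<lambda>n. outer_parallel (inverse (real (Suc n))) K"
  have lm: "?P n \<in> lmeasurable" for n
    by (intro lmeasurable_compact compact_outer_parallel assms)
  have "(\<lambda>n. measure lebesgue (?P n)) \<longlonglongrightarrow> measure lebesgue (\<Inter>n. ?P n)"
  proof (rule Lim_measure_decseq)
    show "range ?P \<subseteq> sets lebesgue"
      using lm fmeasurableD by blast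
    show "decseq ?P"
      unfolding decseq_def
    proof (intro allI impI)
      fix m n :: nat assume "m \<le> n"
      then have "inverse (real (Suc n)) \<le> inverse (real (Suc m))"
        by (intro le_imp_inverse_le) auto
      then show "?P n \<subseteq> ?P m"
        by (rule outer_parallel_mono_radius)
    qed
    show "emeasure lebesgue (?P n) \<noteq> \<infinity>" for n
      using lm[of n] by (simp add: emeasure_eq_measure2)
  qed
  then show ?thesis
    using assms by (simp only: Inter_outer_parallel compact_imp_closed)
qed

section \<open>Volume\<close>

lemma nn_integral_lborel_translate:
  fixes a :: "'a::euclidean_space"
  assumes [measurable]: "f \<in> borel_measurable borel"
  shows "(\<integral>\<^sup>+x. f (x + a) \<partial>lborel) = (\<integral>\<^sup>+x. f x \<partial>lborel)"
proof -
  have "(\<integral>\<^sup>+x. f x \<partial>lborel) = (\<integral>\<^sup>+x. f x \<partial>distr lborel borel ((+) a))"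
    by (simp add: lborel_distr_plus)
  then show ?thesis
    by (simp add: nn_integral_distr add.commute)
qed

text \<open>Each line in direction \<open>u\<close> meets the slab \<open>0 \<le> x \<bullet> u \<le> 1\<close> in unit length, so averaging
  translates of the slab along \<open>u\<close> gives Cavalieri's principle without choosing coordinates.\<close>
lemma emeasure_eq_slab_integral:
  fixes u :: "'a::euclidean_space"
  assumes A[measurable]: "A \<in> sets borel" and u: "norm u = 1"
  shows "emeasure lborel A =
    (\<integral>\<^sup>+x. indicator {0..1} (x \<bullet> u) * emeasure lborel (chord u A x) \<partial>lborel)"
proof -
  have uu: "u \<bullet> u = 1" using u by (simp add: norm_eq_1)
  have one: "(\<integral>\<^sup>+s. indicator {0..1} (c - s) \<partial>lborel) = (1::ennreal)" for c :: real
  proof -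
    have "(\<lambda>s. indicator {0..1} (c - s) :: ennreal) = indicator {c - 1 .. c}"
      by (auto simp: indicator_def fun_eq_iff)
    then show ?thesis by simp
  qed
  have chord_sets: "chord u A x \<in> sets borel" for x
  proof -
    have "(\<lambda>s. x + s *\<^sub>R u) -` A \<inter> space borel \<in> sets borel"
      by (rule measurable_sets[OF _ A]) measurable
    then show ?thesis by (simp add: chord_def vimage_def)
  qed
  have "emeasure lborel A = (\<integral>\<^sup>+x. indicator A x * (\<integral>\<^sup>+s. indicator {0..1} (x \<bullet> u - s) \<partial>lborel) \<partial>lborel)"
    by (simp add: one)
  also have "\<dots> = (\<integral>\<^sup>+x. (\<integral>\<^sup>+s. indicator A x * indicator {0..1} (x \<bullet> u - s) \<partial>lborel) \<partial>lborel)"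
    by (simp add: nn_integral_cmult)
  also have "\<dots> = (\<integral>\<^sup>+s. (\<integral>\<^sup>+x. indicator A x * indicator {0..1} (x \<bullet> u - s) \<partial>lborel) \<partial>lborel)"
    by (rule lborel_pair.Fubini'[symmetric]) measurable
  \<comment> \<open>Translating by \<open>s *\<^sub>R u\<close> makes the slab independent of
    \<open>s\<close>, which is now left to run over the chord of \<open>A\<close>.\<close>
  also have "\<dots> = (\<integral>\<^sup>+s. (\<integral>\<^sup>+x. indicator A (x + s *\<^sub>R u) * indicator {0..1} (x \<bullet> u) \<partial>lborel) \<partial>lborel)"
  proof (rule nn_integral_cong)
    fix s :: real
    let ?f = "\<lambda>x. indicator A x * indicator {0..1} (x \<bullet> u - s) :: ennreal"
    have "(\<integral>\<^sup>+x. ?f x \<partial>lborel) = (\<integral>\<^sup>+x. ?f (x + s *\<^sub>R u) \<partial>lborel)"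
      by (rule nn_integral_lborel_translate[symmetric]) measurable
    then show "(\<integral>\<^sup>+x. ?f x \<partial>lborel) = (\<integral>\<^sup>+x. indicator A (x + s *\<^sub>R u) * indicator {0..1} (x \<bullet> u) \<partial>lborel)"
      using uu by (simp add: inner_simps)
  qed
  also have "\<dots> = (\<integral>\<^sup>+x. (\<integral>\<^sup>+s. indicator A (x + s *\<^sub>R u) * indicator {0..1} (x \<bullet> u) \<partial>lborel) \<partial>lborel)"
    by (rule lborel_pair.Fubini') measurable
  also have "\<dots> = (\<integral>\<^sup>+x. indicator {0..1} (x \<bullet> u) * emeasure lborel (chord u A x) \<partial>lborel)"
  proof (rule nn_integral_cong)
    fix x :: 'a
    have "(\<integral>\<^sup>+s. indicator A (x + s *\<^sub>R u) * indicator {0..1} (x \<bullet> u) \<partial>lborel) =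
      (\<integral>\<^sup>+s. indicator {0..1} (x \<bullet> u) * indicator (chord u A x) s \<partial>lborel)"
      by (intro nn_integral_cong) (auto simp: indicator_def chord_def)
    also have "\<dots> = indicator {0..1} (x \<bullet> u) * emeasure lborel (chord u A x)"
      using chord_sets by (simp add: nn_integral_cmult)
    finally show "(\<integral>\<^sup>+s. indicator A (x + s *\<^sub>R u) * indicator {0..1} (x \<bullet> u) \<partial>lborel) =
      indicator {0..1} (x \<bullet> u) * emeasure lborel (chord u A x)" .
  qed
  finally show ?thesis .
qed

text \<open>The slab integral expresses the volume through chord lengths; compactness makes the sets
  and their chords Borel and of finite measure.\<close>

lemma measure_eqI_chords:
  fixes u :: "'a::euclidean_space"
  assumes "compact A" "compact B" "norm u = 1"
    and "\<And>x. chord_length u A x = chord_length u B x"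
  shows "measure lebesgue A = measure lebesgue B"
proof -
  have "emeasure lborel (chord u C x) = ennreal (chord_length u C x)" if "compact C" for C x
  proof -
    have "chord u C x \<in> sets borel"
      using that assms(3) by (simp add: compact_chord borel_compact)
    moreover have "emeasure lebesgue (chord u C x) = ennreal (measure lebesgue (chord u C x))"
      using chord_lmeasurable[OF that assms(3)] by (simp add: emeasure_eq_measure2)
    ultimately show ?thesis
      by (simp add: chord_length_eq)
  qed
  then have "emeasure lborel A = emeasure lborel B"
    using assms by (simp add: emeasure_eq_slab_integral[of _ u] borel_compact)
  then show ?thesis
    using assms(1,2) by (simp add: measure_def borel_compact)
qed

section \<open>Symmetrization preserves volume\<close>

lemma chord_length_steiner:
  assumes "norm u = 1"
  shows "chord_length u (steiner_symmetral u K) x = chord_length u K x"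
proof (cases "chord u K x = {}")
  case True
  then have "chord u (steiner_symmetral u K) x = {}"
    by (auto simp: chord_def[of _ "steiner_symmetral u K"] mem_steiner_iff[OF assms] chord_shift_empty_iff)
  with True show ?thesis
    by (simp add: chord_length_eq)
next
  case False
  let ?l = "chord_length u K x"
  \<comment> \<open>Seen from the base point \<open>x\<close>, the foot of the line has parameter
    \<open>- (x \<bullet> u)\<close>, which is the centre of the fibre.\<close>
  have "chord u (steiner_symmetral u K) x = {s. \<bar>x \<bullet> u + s\<bar> \<le> ?l / 2}"
    using False assms
    by (auto simp: chord_def[of _ "steiner_symmetral u K"] mem_steiner_iff[OF assms] chord_shift_empty_iff
        chord_length_shift inner_simps norm_eq_1)
  also have "\<dots> = {- (x \<bullet> u) - ?l / 2 .. - (x \<bullet> u) + ?l / 2}"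
    unfolding set_eq_iff mem_Collect_eq atLeastAtMost_iff abs_le_iff by (auto simp: field_simps)
  finally have "chord u (steiner_symmetral u K) x = \<dots>" .
  moreover have "0 \<le> ?l"
    by (simp add: chord_length_eq)
  ultimately show ?thesis
    by (simp add: chord_length_eq[of _ "steiner_symmetral u K"])
qed

lemma measure_steiner:
  assumes "compact K" "norm u = 1"
  shows "measure lebesgue (steiner_symmetral u K) = measure lebesgue K"
  by (rule measure_eqI_chords[OF compact_steiner[OF assms] assms chord_length_steiner[OF assms(2)]])

section \<open>Reflections and small rotations\<close>

text \<open>Reflection in the hyperplane orthogonal to \<open>w\<close>. For \<open>w = 0\<close>
  division by zero yields the identity, which is still orthogonal.\<close>

definition hrefl :: "'a::euclidean_space \<Rightarrow> 'a \<Rightarrow> 'a" where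
  "hrefl w x = x - (2 * (x \<bullet> w) / (w \<bullet> w)) *\<^sub>R w"

lemma orthogonal_hrefl: "orthogonal_transformation (hrefl w)"
  unfolding orthogonal_transformation_def
proof (intro conjI allI)
  show "linear (hrefl w)"
    by (rule linearI) (simp_all add: hrefl_def inner_simps scaleR_diff_right algebra_simps add_divide_distrib)
  show "hrefl w x \<bullet> hrefl w y = x \<bullet> y" for x y
    by (cases "w = 0") (simp_all add: hrefl_def inner_simps field_simps inner_commute)
qed

lemma hrefl_hrefl [simp]: "hrefl w (hrefl w x) = x"
  by (cases "w = 0") (simp_all add: hrefl_def inner_simps field_simps)

lemma hrefl_scaleR: "c \<noteq> 0 \<Longrightarrow> hrefl (c *\<^sub>R w) = hrefl w"
  by (auto simp: hrefl_def fun_eq_iff)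

text \<open>Reflections are conjugate under orthogonal maps, so their determinants can be
  compared.\<close>

lemma hrefl_orthogonal:
  assumes "orthogonal_transformation f"
  shows "hrefl (f w) (f x) = f (hrefl w x)"
  using assms by (simp add: hrefl_def orthogonal_transformation_def linear_diff linear_scale)

lemma compact_orthogonal_image:
  fixes f :: "'a::euclidean_space \<Rightarrow> 'a"
  assumes "orthogonal_transformation f" "compact K"
  shows "compact (f ` K)"
  using assms
  by (intro compact_continuous_image linear_continuous_on)
     (auto simp: orthogonal_transformation_def linear_conv_bounded_linear)

text \<open>A reflection reverses the chords orthogonal to its mirror.\<close>
lemma measure_hrefl_image:
  assumes "compact K"
  shows "measure lebesgue (hrefl w ` K) = measure lebesgue K"
proof (cases "w = 0")
  case True
  then show ?thesis by (simp add: hrefl_def)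
next
  case False
  define u where "u = inverse (norm w) *\<^sub>R w"
  have u: "norm u = 1" and w: "hrefl w = hrefl u"
    using False by (simp_all add: u_def hrefl_scaleR)
  have uu: "u \<bullet> u = 1"
    using u by (simp add: norm_eq_1)
  have chord: "chord u (hrefl u ` K) x = (\<lambda>s. (- 1) *\<^sub>R s + (- 2 * (x \<bullet> u))) ` chord u K x" for x
  proof -
    have "x + s *\<^sub>R u \<in> hrefl u ` K \<longleftrightarrow> x + (- s - 2 * (x \<bullet> u)) *\<^sub>R u \<in> K" for s
    proof -
      have "x + s *\<^sub>R u \<in> hrefl u ` K \<longleftrightarrow> hrefl u (x + s *\<^sub>R u) \<in> K"
        using inj_image_mem_iff[OF orthogonal_transformation_inj[OF orthogonal_hrefl], of u "hrefl u (x + s *\<^sub>R u)" K]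
        by (simp only: hrefl_hrefl)
      also have "hrefl u (x + s *\<^sub>R u) = x + (- s - 2 * (x \<bullet> u)) *\<^sub>R u"
        using uu by (simp add: hrefl_def inner_simps algebra_simps flip: scaleR_add_left)
      finally show ?thesis .
    qed
    then have "s \<in> chord u (hrefl u ` K) x \<longleftrightarrow> - s - 2 * (x \<bullet> u) \<in> chord u K x" for s
      by (simp add: chord_def)
    then show ?thesis
      by (force simp: image_iff)
  qed
  have "measure lebesgue (hrefl u ` K) = measure lebesgue K"
  proof (rule measure_eqI_chords[OF _ assms u])
    show "compact (hrefl u ` K)"
      by (rule compact_orthogonal_image[OF orthogonal_hrefl assms])
    show "chord_length u (hrefl u ` K) x = chord_length u K x" for x
      using measure_lebesgue_affine[of "-1" "- 2 * (x \<bullet> u)" "chord u K x"]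
      by (simp only: chord_length_eq chord) simp
  qed
  then show ?thesis
    by (simp only: w)
qed

text \<open>The rotation in the plane of the unit vectors \<open>v\<close> and \<open>e\<close> that takes \<open>v\<close> to \<open>e\<close>,
  provided \<open>e \<noteq> - v\<close>.\<close>
definition turn :: "'a::euclidean_space \<Rightarrow> 'a \<Rightarrow> 'a \<Rightarrow> 'a" where
  "turn v e = hrefl (e + v) \<circ> hrefl v"

lemma orthogonal_turn: "orthogonal_transformation (turn v e)"
  unfolding turn_def by (intro orthogonal_transformation_compose orthogonal_hrefl)

lemma turn_apply:
  assumes "norm e = 1" "norm v = 1" "e \<bullet> v \<noteq> -1"
  shows "turn v e v = e"
proof -
  have [simp]: "e \<bullet> e = 1" "v \<bullet> v = 1"
    using assms by (simp_all add: norm_eq_1)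
  have 1: "hrefl v v = - v"
    by (simp add: hrefl_def scaleR_2)
  have "2 * (1 + e \<bullet> v) \<noteq> 0"
    using assms by simp
  then have "2 * (- v \<bullet> (e + v)) / ((e + v) \<bullet> (e + v)) = - 1"
    by (simp add: inner_simps inner_commute divide_simps)
  then have "hrefl (e + v) (- v) = e"
    by (simp only: hrefl_def) simp
  with 1 show ?thesis
    by (simp add: turn_def)
qed

text \<open>The vector \<open>y - k *\<^sub>R (e + v)\<close>, with \<open>k\<close> chosen to make
  it orthogonal to \<open>v\<close>, is fixed by \<open>hrefl v\<close> and sent to \<open>y\<close>
  by \<open>hrefl (e + v)\<close>; the remaining part \<open>t *\<^sub>R v\<close> turns into
  \<open>t *\<^sub>R e\<close>.\<close>

lemma turn_inverse:
  assumes "norm e = 1" "norm v = 1" "e \<bullet> v \<noteq> -1" "y \<bullet> e = 0" and z: "turn v e z = y + t *\<^sub>R e"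
  shows "z = y + t *\<^sub>R v - ((y \<bullet> v) / (1 + e \<bullet> v)) *\<^sub>R (e + v)"
proof -
  have [simp]: "e \<bullet> e = 1" "v \<bullet> v = 1"
    using assms by (simp_all add: norm_eq_1)
  have ne: "1 + e \<bullet> v \<noteq> 0"
    using assms by simp
  define k where "k = (y \<bullet> v) / (1 + e \<bullet> v)"
  let ?x = "y + t *\<^sub>R v - k *\<^sub>R (e + v)"
  have k: "k + k * (e \<bullet> v) = y \<bullet> v"
  proof -
    have "k * (1 + e \<bullet> v) = y \<bullet> v"
      using ne by (simp add: k_def)
    then show ?thesis
      by (simp only: distrib_left mult_1_right)
  qed
  have "hrefl v (y - k *\<^sub>R (e + v)) = y - k *\<^sub>R (e + v)"
  proof -
    have "(y - k *\<^sub>R (e + v)) \<bullet> v = 0"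
      using k by (simp add: inner_simps algebra_simps)
    then show ?thesis
      by (simp only: hrefl_def) simp
  qed
  moreover have "hrefl (e + v) (y - k *\<^sub>R (e + v)) = y"
  proof -
    have "(y - k *\<^sub>R (e + v)) \<bullet> (e + v) = - (y \<bullet> v)"
      using k assms(4) by (simp add: inner_simps inner_commute algebra_simps)
    moreover have "(e + v) \<bullet> (e + v) = 2 * (1 + e \<bullet> v)"
      by (simp add: inner_simps inner_commute)
    ultimately have "2 * ((y - k *\<^sub>R (e + v)) \<bullet> (e + v)) / ((e + v) \<bullet> (e + v)) = - k"
      using ne by (simp add: field_simps flip: k)
    then show ?thesis
      by (simp only: hrefl_def) simp
  qed
  ultimately have "turn v e (y - k *\<^sub>R (e + v)) = y"
    by (simp add: turn_def)
  moreover have "?x = (y - k *\<^sub>R (e + v)) + t *\<^sub>R v"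
    by simp
  ultimately have "turn v e ?x = y + t *\<^sub>R e"
    using orthogonal_turn[of v e] turn_apply[OF assms(1-3)]
    by (simp only: orthogonal_transformation_def linear_add linear_scale)
  then show ?thesis
    using z orthogonal_transformation_inj[OF orthogonal_turn[of v e]] by (metis injD k_def)
qed

lemma measure_turn_image:
  assumes "compact K"
  shows "measure lebesgue (turn v e ` K) = measure lebesgue K"
  using assms
  by (simp only: turn_def image_comp[symmetric] measure_hrefl_image
      compact_orthogonal_image[OF orthogonal_hrefl])

section \<open>An almost monotone functional\<close>

text \<open>For a unit vector \<open>e\<close>, a sublevel set meets each line parallel to
  \<open>e\<close> in a possibly empty segment centred on the hyperplane orthogonal to
  \<open>e\<close>.\<close>

definition quad :: "'a::euclidean_space \<Rightarrow> real \<Rightarrow> 'a \<Rightarrow> 'a \<Rightarrow> real" where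
  "quad e A p x = (x \<bullet> e)\<^sup>2 - A * (norm (x - (x \<bullet> e) *\<^sub>R e - p))\<^sup>2"

text \<open>The scalar part of the estimate for one step: \<open>c\<close> and \<open>s\<close> are
  the cosine and the squared sine of the angle, \<open>N\<close> is the squared distance of the foot
  from \<open>p\<close>, and \<open>\<eta>\<close>, \<open>\<xi>\<close>, \<open>k\<close> are of
  first order in the angle.\<close>

lemma quad_rotation_estimate:
  fixes t c s A N \<eta> \<xi> k R b :: real
  assumes hyp: "(t * c - \<eta>)\<^sup>2 - A * (N + 2 * (t - k) * \<xi> + (t - k)\<^sup>2 * s) \<le> b"
    and c: "c\<^sup>2 = 1 - s" and s: "0 \<le> s" "s \<le> 1" and A: "0 \<le> A"
    and t: "t\<^sup>2 \<le> R\<^sup>2" and \<eta>: "\<eta>\<^sup>2 \<le> s * R\<^sup>2" and k: "k\<^sup>2 \<le> s * R\<^sup>2" and \<xi>: "\<xi>\<^sup>2 \<le> 4 * s * R\<^sup>2"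
  shows "(t - (c * \<eta> + A * \<xi>))\<^sup>2 \<le> b + A * N + R\<^sup>2 * (3 + 9 * A + 8 * A\<^sup>2) * s"
proof -
  \<comment> \<open>Completing the square in \<open>t\<close> gathers both first-order terms in the
    centre \<open>c * \<eta> + A * \<xi>\<close>; what follows \<open>A * N\<close> is of order
    \<open>s\<close>.\<close>
  have id: "(t - (c * \<eta> + A * \<xi>))\<^sup>2 =
      ((t * c - \<eta>)\<^sup>2 - A * (N + 2 * (t - k) * \<xi> + (t - k)\<^sup>2 * s)) + A * N
      + (1 - c\<^sup>2) * t\<^sup>2 - \<eta>\<^sup>2 + (c * \<eta> + A * \<xi>)\<^sup>2 - A * (2 * k * \<xi>) + A * ((t - k)\<^sup>2 * s)"
    by (simp add: power2_eq_square algebra_simps)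
  have 1: "(1 - c\<^sup>2) * t\<^sup>2 \<le> s * R\<^sup>2"
    using t s by (simp add: c mult_left_mono)
  have 2: "(c * \<eta> + A * \<xi>)\<^sup>2 \<le> 2 * (s * R\<^sup>2) + A\<^sup>2 * (8 * s * R\<^sup>2)"
  proof -
    have "(c * \<eta> + A * \<xi>)\<^sup>2 \<le> 2 * (c\<^sup>2 * \<eta>\<^sup>2) + A\<^sup>2 * (2 * \<xi>\<^sup>2)"
      using zero_le_power2[of "c * \<eta> - A * \<xi>"] by (simp add: power2_eq_square algebra_simps)
    moreover have "c\<^sup>2 * \<eta>\<^sup>2 \<le> 1 * (s * R\<^sup>2)"
      using c s \<eta> by (intro mult_mono) auto
    moreover have "A\<^sup>2 * (2 * \<xi>\<^sup>2) \<le> A\<^sup>2 * (8 * s * R\<^sup>2)"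
      using \<xi> by (intro mult_left_mono) auto
    ultimately show ?thesis by linarith
  qed
  have "A * (- (2 * k * \<xi>)) \<le> A * (5 * s * R\<^sup>2)"
  proof (intro mult_left_mono A)
    have "- (2 * k * \<xi>) \<le> k\<^sup>2 + \<xi>\<^sup>2"
      using zero_le_power2[of "k + \<xi>"] by (simp add: power2_eq_square algebra_simps)
    then show "- (2 * k * \<xi>) \<le> 5 * s * R\<^sup>2"
      using k \<xi> by linarith
  qed
  then have 3: "- (A * (2 * k * \<xi>)) \<le> A * (5 * s * R\<^sup>2)"
    by (simp only: mult_minus_right)
  have 4: "A * ((t - k)\<^sup>2 * s) \<le> A * (4 * R\<^sup>2 * s)"
  proof (intro mult_left_mono mult_right_mono A s)
    have "(t - k)\<^sup>2 \<le> 2 * t\<^sup>2 + 2 * k\<^sup>2"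
      using zero_le_power2[of "t + k"] by (simp add: power2_eq_square algebra_simps)
    moreover have "s * R\<^sup>2 \<le> 1 * R\<^sup>2"
      using s by (intro mult_right_mono) auto
    ultimately show "(t - k)\<^sup>2 \<le> 4 * R\<^sup>2"
      using t k by linarith
  qed
  \<comment> \<open>The constant collects \<open>1\<close> from \<open>1 - c\<^sup>2\<close>,
    \<open>2 + 8 * A\<^sup>2\<close> from the square of the centre, and \<open>5 * A\<close> and
    \<open>4 * A\<close> from the two terms with \<open>k\<close>.\<close>
  have "(t - (c * \<eta> + A * \<xi>))\<^sup>2 \<le> b + A * N + s * R\<^sup>2 + (2 * (s * R\<^sup>2) + A\<^sup>2 * (8 * s * R\<^sup>2))
      + A * (5 * s * R\<^sup>2) + A * (4 * R\<^sup>2 * s)"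
    using hyp 1 2 3 4 zero_le_power2[of \<eta>] unfolding id by linarith
  also have "\<dots> = b + A * N + R\<^sup>2 * (3 + 9 * A + 8 * A\<^sup>2) * s"
    by (simp add: algebra_simps)
  finally show ?thesis .
qed

text \<open>To first order in the angle, the rotation moves the region \<open>quad e A p \<le> b\<close> along \<open>e\<close>
  by the same amount at both ends of each chord; symmetrization undoes this shift.\<close>
lemma quad_steiner_turn_le:
  assumes e: "norm e = 1" and v: "norm v = 1" and ev: "0 \<le> e \<bullet> v"
    and p: "p \<bullet> e = 0" "norm p \<le> R" and A: "0 \<le> A" and K: "K \<subseteq> cball 0 R"
    and b: "\<And>z. z \<in> K \<Longrightarrow> quad e A p z \<le> b"
    and x: "x \<in> steiner_symmetral e (turn v e ` K)"
  shows "quad e A p x \<le> b + R\<^sup>2 * (3 + 9 * A + 8 * A\<^sup>2) * (1 - (e \<bullet> v)\<^sup>2)"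
proof -
  define y where "y = x + (- (x \<bullet> e)) *\<^sub>R e"
  define c where "c = e \<bullet> v"
  define s where "s = 1 - c\<^sup>2"
  \<comment> \<open>\<open>d\<close> is the component of \<open>v\<close> orthogonal to
    \<open>e\<close>. Its length is the sine of the angle, so inner products with it are of first
    order.\<close>
  define d where "d = v - c *\<^sub>R e"
  define k where "k = (y \<bullet> v) / (1 + c)"
  have ee [simp]: "e \<bullet> e = 1" "v \<bullet> v = 1"
    using e v by (simp_all add: norm_eq_1)
  have ye: "y \<bullet> e = 0" "e \<bullet> y = 0" by (simp_all add: y_def inner_simps inner_commute)
  have c: "0 \<le> c" "\<bar>c\<bar> \<le> 1"
    using ev Cauchy_Schwarz_ineq2[of e v] e v by (auto simp: c_def)
  have s: "0 \<le> s" "s \<le> 1"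
    using c by (auto simp: s_def abs_square_le_1)
  have dd: "(norm d)\<^sup>2 = s"
    unfolding power2_norm_eq_inner by (simp add: d_def s_def c_def inner_simps inner_commute power2_eq_square)
  have yd: "y \<bullet> d = y \<bullet> v"
    by (simp add: d_def inner_simps ye)
  have cs: "(z \<bullet> d)\<^sup>2 \<le> (norm z)\<^sup>2 * s" for z
    using Cauchy_Schwarz_ineq[of z d] by (simp add: power2_norm_eq_inner flip: dd)
  let ?N = "(norm (y - p))\<^sup>2"
  let ?\<xi> = "(y - p) \<bullet> d"
  let ?B = "b + A * ?N + R\<^sup>2 * (3 + 9 * A + 8 * A\<^sup>2) * s"
  have "0 \<le> ?B \<and> chord_length e (turn v e ` K) y \<le> 2 * sqrt ?B"
  proof (rule chord_in_interval)
    show "chord e (turn v e ` K) y \<noteq> {}"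
      using x unfolding y_def chord_shift_empty_iff by (simp add: mem_steiner_iff[OF e])
    fix t assume "t \<in> chord e (turn v e ` K) y"
    then obtain z where "z \<in> K" and z: "turn v e z = y + t *\<^sub>R e"
      by (auto simp: chord_def)
    \<comment> \<open>Before the turn the chord point \<open>y + t *\<^sub>R e\<close> was the point
      \<open>z\<close> of \<open>K\<close>, where the bound \<open>b\<close> is known.\<close>
    have zeq: "z = y + t *\<^sub>R v - k *\<^sub>R (e + v)"
      unfolding k_def c_def using ev by (intro turn_inverse[OF e v _ ye(1) z]) auto
    have "norm (y + t *\<^sub>R e) = norm z"
      using z orthogonal_transformation_norm[OF orthogonal_turn] by metis
    then have "(norm (y + t *\<^sub>R e))\<^sup>2 \<le> R\<^sup>2"
      using K \<open>z \<in> K\<close> by (auto intro!: power_mono)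
    moreover have "(norm (y + t *\<^sub>R e))\<^sup>2 = (norm y)\<^sup>2 + t\<^sup>2"
      unfolding power2_norm_eq_inner by (simp add: inner_simps ye power2_eq_square)
    ultimately have yt: "(norm y)\<^sup>2 \<le> R\<^sup>2" "t\<^sup>2 \<le> R\<^sup>2"
      using zero_le_power2[of t] zero_le_power2[of "norm y"] by linarith+
    have R: "0 \<le> R"
      using p(2) norm_ge_zero order_trans by blast
    have kc: "k * (1 + c) = y \<bullet> v"
      using c by (simp add: k_def)
    have ze: "z \<bullet> e = t * c - y \<bullet> d"
    proof -
      have "z \<bullet> e = t * c - k * (1 + c)"
        by (simp add: zeq inner_simps ye c_def inner_commute)
      then show ?thesis by (simp add: kc yd)
    qed
    have "z - (z \<bullet> e) *\<^sub>R e - p = (y - p) + (t - k) *\<^sub>R d"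
    proof -
      have "z - (z \<bullet> e) *\<^sub>R e - p = (y - p) + (t - k) *\<^sub>R v - (k + (z \<bullet> e)) *\<^sub>R e"
        by (simp add: zeq algebra_simps)
      also have "k + z \<bullet> e = (t - k) * c"
        unfolding ze yd kc[symmetric] by (simp add: algebra_simps)
      finally show ?thesis
        by (simp add: d_def algebra_simps)
    qed
    then have norm_z: "norm (z - (z \<bullet> e) *\<^sub>R e - p) = norm ((y - p) + (t - k) *\<^sub>R d)"
      by (rule arg_cong)
    have "(norm (z - (z \<bullet> e) *\<^sub>R e - p))\<^sup>2 = ?N + 2 * (t - k) * ?\<xi> + (t - k)\<^sup>2 * s"
      unfolding norm_z dd[symmetric] power2_norm_eq_inner
      by (simp add: inner_simps inner_commute power2_eq_square algebra_simps)
    then have hyp: "(t * c - y \<bullet> d)\<^sup>2 - A * (?N + 2 * (t - k) * ?\<xi> + (t - k)\<^sup>2 * s) \<le> b"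
      using b[OF \<open>z \<in> K\<close>] by (simp add: quad_def ze)
    have \<eta>: "(y \<bullet> d)\<^sup>2 \<le> s * R\<^sup>2"
      using cs[of y] mult_right_mono[OF yt(1) s(1)] by (simp add: mult.commute)
    have "k\<^sup>2 * 1 \<le> k\<^sup>2 * (1 + c)\<^sup>2"
      using c by (intro mult_left_mono one_le_power) auto
    also have "\<dots> = (y \<bullet> d)\<^sup>2"
      by (simp add: yd flip: kc power_mult_distrib)
    finally have k2: "k\<^sup>2 \<le> s * R\<^sup>2"
      using \<eta> by simp
    have "norm y \<le> R"
      using yt(1) R by (rule power2_le_imp_le)
    then have "norm (y - p) \<le> 2 * R"
      using norm_triangle_ineq4[of y p] p(2) by linarith
    then have "(norm (y - p))\<^sup>2 \<le> (2 * R)\<^sup>2"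
      by (intro power_mono) auto
    then have \<xi>: "?\<xi>\<^sup>2 \<le> 4 * s * R\<^sup>2"
      using cs[of "y - p"] mult_right_mono[OF _ s(1)] by (fastforce simp: power_mult_distrib algebra_simps)
    \<comment> \<open>The centre depends on \<open>y\<close> but not on \<open>t\<close>, so one
      interval contains the whole chord.\<close>
    show "(t - (c * (y \<bullet> d) + A * ?\<xi>))\<^sup>2 \<le> ?B"
      using quad_rotation_estimate[OF hyp _ s A yt(2) \<eta> k2 \<xi>] by (simp add: s_def)
  qed
  then have "0 \<le> ?B" "\<bar>x \<bullet> e\<bar> \<le> sqrt ?B"
    using x unfolding y_def chord_length_shift by (auto simp: mem_steiner_iff[OF e])
  then have "\<bar>x \<bullet> e\<bar>\<^sup>2 \<le> ?B"
    by (metis abs_ge_zero power_mono real_sqrt_pow2)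
  then show ?thesis
    by (simp add: quad_def y_def s_def c_def)
qed

section \<open>Turning and symmetrizing\<close>

text \<open>\<open>v m\<close> stands for the next direction as seen after the rotations made so
  far; it is turned to the fixed direction \<open>e\<close> before symmetrizing.\<close>

primrec turned_steiner :: "'a::euclidean_space \<Rightarrow> (nat \<Rightarrow> 'a) \<Rightarrow> nat \<Rightarrow> 'a set \<Rightarrow> 'a set" where
  "turned_steiner e v 0 K = K"
| "turned_steiner e v (Suc m) K = steiner_symmetral e (turn (v m) e ` turned_steiner e v m K)"

text \<open>The summand is the squared sine of the angle between \<open>e\<close> and
  \<open>v m\<close>.\<close>

locale slow_turning =
  fixes e :: "'a::euclidean_space" and v :: "nat \<Rightarrow> 'a"
  assumes norm_e: "norm e = 1" and norm_v: "\<And>m. norm (v m) = 1"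
    and inner_nonneg: "\<And>m. 0 \<le> e \<bullet> v m"
    and summable: "summable (\<lambda>m. 1 - (e \<bullet> v m)\<^sup>2)"
begin

abbreviation body :: "nat \<Rightarrow> 'a set \<Rightarrow> 'a set" where
  "body \<equiv> turned_steiner e v"

section \<open>Properties that persist along the sequence\<close>

lemma compact_body: "compact K \<Longrightarrow> compact (body m K)"
  by (induction m) (simp_all add: compact_steiner norm_e compact_orthogonal_image orthogonal_turn)

lemma body_nonempty: "K \<noteq> {} \<Longrightarrow> body m K \<noteq> {}"
  by (induction m) (simp_all add: steiner_nonempty norm_e)

lemma turn_in_cball: "K \<subseteq> cball 0 R \<Longrightarrow> turn w e ` K \<subseteq> cball 0 R"
  using orthogonal_transformation_norm[OF orthogonal_turn[of w e]] by auto

lemma body_in_cball: "K \<subseteq> cball 0 R \<Longrightarrow> body m K \<subseteq> cball 0 R"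
  by (induction m) (simp_all add: steiner_in_cball norm_e turn_in_cball)

lemma measure_body: "compact K \<Longrightarrow> measure lebesgue (body m K) = measure lebesgue K"
  by (induction m) (simp_all add: measure_steiner norm_e compact_orthogonal_image orthogonal_turn
      compact_body measure_turn_image)

text \<open>Rotations commute with taking parallel sets, and
  \<open>steiner_outer_parallel_subset\<close> handles the symmetrizations. The purpose is a bound,
  uniform in \<open>m\<close>, for the volume of the parallel sets of
  \<open>body m K\<close>.\<close>

lemma body_outer_parallel_subset:
  assumes "compact K"
  shows "outer_parallel \<delta> (body m K) \<subseteq> body m (outer_parallel \<delta> K)"
proof (induction m)
  case (Suc m)
  let ?T = "turn (v m) e"
  have "outer_parallel \<delta> (body (Suc m) K) \<subseteq> steiner_symmetral e (outer_parallel \<delta> (?T ` body m K))"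
    using assms by (simp add: steiner_outer_parallel_subset norm_e compact_orthogonal_image
        orthogonal_turn compact_body)
  also have "outer_parallel \<delta> (?T ` body m K) = ?T ` outer_parallel \<delta> (body m K)"
    by (rule outer_parallel_image_orthogonal[OF orthogonal_turn])
  also have "steiner_symmetral e \<dots> \<subseteq> steiner_symmetral e (?T ` body m (outer_parallel \<delta> K))"
    using assms Suc
    by (intro steiner_mono image_mono compact_orthogonal_image orthogonal_turn norm_e
        compact_outer_parallel compact_body)
  finally show ?case by simp
qed simp

text \<open>All bodies stay in the same ball, so the estimate for one step has the same constant
  throughout and the errors add up.\<close>

lemma body_quad_le:
  assumes K: "K \<subseteq> cball 0 R" and p: "p \<bullet> e = 0" "norm p \<le> R" and A: "0 \<le> A"
    and b: "\<And>z. z \<in> body m K \<Longrightarrow> quad e A p z \<le> b" and "m \<le> n" and z: "z \<in> body n K"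
  shows "quad e A p z \<le> b + R\<^sup>2 * (3 + 9 * A + 8 * A\<^sup>2) * (\<Sum>i = m..<n. 1 - (e \<bullet> v i)\<^sup>2)"
  using \<open>m \<le> n\<close> z
proof (induction n arbitrary: z rule: dec_induct)
  case base
  then show ?case using b by simp
next
  case (step n)
  have "quad e A p z \<le> (b + R\<^sup>2 * (3 + 9 * A + 8 * A\<^sup>2) * (\<Sum>i = m..<n. 1 - (e \<bullet> v i)\<^sup>2))
      + R\<^sup>2 * (3 + 9 * A + 8 * A\<^sup>2) * (1 - (e \<bullet> v n)\<^sup>2)"
    using step.prems
    by (intro quad_steiner_turn_le[OF norm_e norm_v inner_nonneg p A body_in_cball[OF K] step.IH]) auto
  also have "\<dots> = b + R\<^sup>2 * (3 + 9 * A + 8 * A\<^sup>2) * (\<Sum>i = m..<Suc n. 1 - (e \<bullet> v i)\<^sup>2)"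
    using \<open>m \<le> n\<close> by (simp add: algebra_simps)
  finally show ?case .
qed

text \<open>At least one symmetrization must have taken place: \<open>body 0 K\<close> is
  \<open>K\<close> itself, whose fibres are arbitrary.\<close>

lemma body_fibre_convex:
  assumes "1 \<le> m" "z \<in> body m K" "\<bar>t\<bar> \<le> \<bar>z \<bullet> e\<bar>"
  shows "z + (t - z \<bullet> e) *\<^sub>R e \<in> body m K"
  using assms by (cases m) (auto intro: steiner_fibre_convex[OF norm_e])

text \<open>The upper Kuratowski limit: the points each neighbourhood of which meets
  \<open>body m K\<close> for infinitely many \<open>m\<close>.\<close>

definition limit_body :: "'a set \<Rightarrow> 'a set" where
  "limit_body K = (\<Inter>N. closure (\<Union>m\<in>{N..}. body m K))"

lemma compact_tail:
  assumes "compact K"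
  shows "compact (closure (\<Union>m\<in>{N..}. body m K))"
proof -
  obtain R where "K \<subseteq> cball 0 R"
    using compact_imp_bounded[OF assms] unfolding bounded_iff by force
  then have "(\<Union>m\<in>{N..}. body m K) \<subseteq> cball 0 R"
    using body_in_cball by blast
  then show ?thesis
    using bounded_subset[OF bounded_cball] compact_closure by blast
qed

lemma compact_limit_body:
  assumes "compact K"
  shows "compact (limit_body K)"
  unfolding limit_body_def using compact_tail[OF assms]
  by (intro compact_Inter) auto

lemma tail_antimono: "N \<le> N' \<Longrightarrow> closure (\<Union>m\<in>{N'..}. body m K) \<subseteq> closure (\<Union>m\<in>{N..}. body m K)"
  by (intro closure_mono UN_mono) auto

lemma tail_nonempty: "K \<noteq> {} \<Longrightarrow> closure (\<Union>m\<in>{N..}. body m K) \<noteq> {}"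
  using body_nonempty[of K N] by auto

lemma limit_body_nonempty:
  assumes "compact K" "K \<noteq> {}"
  shows "limit_body K \<noteq> {}"
  unfolding limit_body_def using compact_tail tail_nonempty tail_antimono assms
  by (intro compact_nest)

text \<open>Otherwise the closed tails, with the open neighbourhood \<open>?U\<close> of the limit
  body removed, would be nested non-empty compact sets. A common point would lie in the limit body
  and outside \<open>?U\<close>.\<close>

lemma eventually_body_subset:
  assumes "compact K" "0 < \<delta>"
  shows "\<forall>\<^sub>F m in sequentially. body m K \<subseteq> outer_parallel \<delta> (limit_body K)"
proof -
  let ?G = "\<lambda>N. closure (\<Union>m\<in>{N..}. body m K)"
  let ?U = "\<Union>x\<in>limit_body K. ball x \<delta>"
  have "\<exists>N. ?G N - ?U = {}"
  proof (rule ccontr)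
    assume "\<not> ?thesis"
    then have ne: "?G N - ?U \<noteq> {}" for N by blast
    have "(\<Inter>N. ?G N - ?U) \<noteq> {}"
    proof (rule compact_nest[OF _ ne])
      show "compact (?G N - ?U)" for N
        by (intro compact_diff compact_tail assms open_UN) auto
      show "?G N' - ?U \<subseteq> ?G N - ?U" if "N \<le> N'" for N N'
        using tail_antimono[OF that] by blast
    qed
    then obtain x where "\<And>N. x \<in> ?G N" "x \<notin> ?U" by blast
    then have "x \<in> limit_body K" "x \<notin> ?U"
      by (auto simp: limit_body_def)
    then show False
      using \<open>0 < \<delta>\<close> by auto
  qed
  then obtain N where N: "?G N \<subseteq> ?U" by blast
  have "body m K \<subseteq> outer_parallel \<delta> (limit_body K)" if "N \<le> m" for m
  proof -
    have "body m K \<subseteq> ?G N"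
      using that closure_subset by fastforce
    also have "\<dots> \<subseteq> ?U" by (rule N)
    also have "\<dots> \<subseteq> outer_parallel \<delta> (limit_body K)"
      by (force simp: mem_outer_parallel)
    finally show ?thesis .
  qed
  then show ?thesis
    unfolding eventually_sequentially by blast
qed

section \<open>The bodies stay near every limit point\<close>

lemma tail_sum_small:
  assumes "0 < \<epsilon>"
  obtains N where "1 \<le> N" "\<And>m n. N \<le> m \<Longrightarrow> (\<Sum>i = m..<n. 1 - (e \<bullet> v i)\<^sup>2) < \<epsilon>"
proof -
  obtain N where "\<forall>m\<ge>N. \<forall>n. norm (\<Sum>i = m..<n. 1 - (e \<bullet> v i)\<^sup>2) < \<epsilon>"
    using summable assms unfolding summable_Cauchy by blast
  then have N: "norm (\<Sum>i = m..<n. 1 - (e \<bullet> v i)\<^sup>2) < \<epsilon>" if "N \<le> m" for m n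
    using that by blast
  \<comment> \<open>The maximum with 1 guarantees the one symmetrization that
    \<open>body_fibre_convex\<close> asks for.\<close>
  show thesis
  proof (rule that[of "max 1 N"])
    show "(\<Sum>i = m..<n. 1 - (e \<bullet> v i)\<^sup>2) < \<epsilon>" if "max 1 N \<le> m" for m n
      using N[of m n] that by simp
  qed simp
qed

text \<open>If \<open>body m K\<close> misses the ball, then by symmetry it misses a whole cylinder around it, and
  for large \<open>A\<close> the hyperboloid \<open>quad e A p \<le> t\<^sup>2 - \<eta>\<close> separates it from \<open>x = p + t e\<close>.\<close>
lemma quad_le_of_gap:
  assumes m: "1 \<le> m" and K: "K \<subseteq> cball 0 R" and \<epsilon>: "0 < \<epsilon>"
    and gap: "\<And>z. z \<in> body m K \<Longrightarrow> \<epsilon> \<le> dist z x"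
    and z: "z \<in> body m K"
  shows "quad e (4 * (R\<^sup>2 + 1) / \<epsilon>\<^sup>2) (x - (x \<bullet> e) *\<^sub>R e) z \<le> (x \<bullet> e)\<^sup>2 - min 1 (\<epsilon>\<^sup>2 / 4)"
proof -
  \<comment> \<open>Chosen so that \<open>A * (\<epsilon> / 2)\<^sup>2 = R\<^sup>2 + 1\<close>: at
    distance at least \<open>\<epsilon> / 2\<close> from the line through \<open>x\<close> in
    direction \<open>e\<close>, the value of \<open>quad\<close> on the body is at most
    \<open>- 1\<close>.\<close>
  define A where "A = 4 * (R\<^sup>2 + 1) / \<epsilon>\<^sup>2"
  define t where "t = z \<bullet> e"
  define t0 where "t0 = x \<bullet> e"
  define w where "w = z - t *\<^sub>R e - (x - t0 *\<^sub>R e)"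
  have quad: "quad e A (x - (x \<bullet> e) *\<^sub>R e) z = t\<^sup>2 - A * (norm w)\<^sup>2"
    by (simp add: quad_def t_def t0_def w_def)
  have A: "0 \<le> A" by (simp add: A_def)
  show ?thesis
  proof (cases "\<epsilon> / 2 \<le> norm w")
    case True
    have "norm z \<le> R"
      using subsetD[OF body_in_cball[OF K] z] by simp
    moreover have "\<bar>t\<bar> \<le> norm z"
      using Cauchy_Schwarz_ineq2[of z e] norm_e by (simp add: t_def)
    ultimately have "\<bar>t\<bar>\<^sup>2 \<le> R\<^sup>2"
      by (intro power_mono) auto
    moreover have "A * (\<epsilon> / 2)\<^sup>2 \<le> A * (norm w)\<^sup>2"
      using True \<epsilon> A by (intro mult_left_mono power_mono) auto
    moreover have "A * (\<epsilon> / 2)\<^sup>2 = R\<^sup>2 + 1"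
      using \<epsilon> by (simp add: A_def power_divide)
    moreover have "min 1 (\<epsilon>\<^sup>2 / 4) \<le> 1" by simp
    ultimately show ?thesis
      using zero_le_power2[of "x \<bullet> e"] unfolding A_def[symmetric] quad power2_abs by linarith
  next
    case False
    have "\<bar>t\<bar> < \<bar>t0\<bar> - \<epsilon> / 2"
    proof (rule ccontr)
      assume *: "\<not> ?thesis"
      \<comment> \<open>\<open>t'\<close> is \<open>t0\<close> moved towards 0 by at most
        \<open>\<epsilon> / 2\<close>. If the claim fails, it is a height in the fibre through
        \<open>z\<close>, which yields a point of the body too close to \<open>x\<close>.\<close>
      define t' where "t' = (if \<bar>t0\<bar> \<le> \<epsilon> / 2 then 0 else t0 - sgn t0 * (\<epsilon> / 2))"
      have t': "\<bar>t'\<bar> \<le> \<bar>t\<bar>" "\<bar>t' - t0\<bar> \<le> \<epsilon> / 2"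
        using * \<epsilon> by (auto simp: t'_def sgn_if)
      have "z + (t' - t) *\<^sub>R e \<in> body m K"
        using body_fibre_convex[OF m z] t'(1) by (simp add: t_def)
      then have "\<epsilon> \<le> dist (z + (t' - t) *\<^sub>R e) x"
        by (rule gap)
      also have "\<dots> = norm (w + (t' - t0) *\<^sub>R e)"
        by (simp add: dist_norm w_def algebra_simps)
      also have "\<dots> \<le> norm w + \<bar>t' - t0\<bar>"
        using norm_triangle_ineq[of w "(t' - t0) *\<^sub>R e"] norm_e by simp
      also have "\<dots> < \<epsilon>"
        using False t'(2) by linarith
      finally show False by simp
    qed
    then have "\<epsilon> / 2 \<le> \<bar>t0\<bar>" and "\<bar>t\<bar>\<^sup>2 \<le> (\<bar>t0\<bar> - \<epsilon> / 2)\<^sup>2"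
      by linarith (intro power_mono, use \<open>\<bar>t\<bar> < _\<close> in auto)
    moreover have "(\<bar>t0\<bar> - \<epsilon> / 2)\<^sup>2 = t0\<^sup>2 - \<bar>t0\<bar> * \<epsilon> + \<epsilon>\<^sup>2 / 4"
      by (simp add: power2_eq_square algebra_simps)
    moreover have "\<epsilon> / 2 * \<epsilon> \<le> \<bar>t0\<bar> * \<epsilon>"
      using \<open>\<epsilon> / 2 \<le> \<bar>t0\<bar>\<close> \<epsilon> by (intro mult_right_mono) auto
    moreover have "0 \<le> A * (norm w)\<^sup>2"
      using A by (intro mult_nonneg_nonneg) auto
    ultimately have "t\<^sup>2 - A * (norm w)\<^sup>2 \<le> t0\<^sup>2 - \<epsilon>\<^sup>2 / 4"
      unfolding power2_abs using power2_eq_square[of \<epsilon>] by linarith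
    then show ?thesis
      unfolding A_def[symmetric] quad t0_def by (rule order_trans) simp
  qed
qed

text \<open>If the bodies missed the ball about \<open>x\<close> at arbitrarily late times, one such
  time would put \<open>quad\<close> below its value at \<open>x\<close> by a margin
  \<open>\<eta>\<close>. All later steps together cost at most half of this margin, so the closure
  of the tail would exclude \<open>x\<close>.\<close>

lemma eventually_body_near:
  assumes K: "compact K" and x: "x \<in> limit_body K" and \<epsilon>: "0 < \<epsilon>"
  shows "\<forall>\<^sub>F m in sequentially. \<exists>z\<in>body m K. dist z x < \<epsilon>"
proof (rule ccontr)
  assume contra: "\<not> ?thesis"
  obtain R where R: "K \<subseteq> cball 0 R"
    using compact_imp_bounded[OF K] unfolding bounded_iff by force
  define A where "A = 4 * (R\<^sup>2 + 1) / \<epsilon>\<^sup>2"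
  define p where "p = x - (x \<bullet> e) *\<^sub>R e"
  define \<eta> where "\<eta> = min 1 (\<epsilon>\<^sup>2 / 4)"
  define C where "C = R\<^sup>2 * (3 + 9 * A + 8 * A\<^sup>2)"
  have ee: "e \<bullet> e = 1" using norm_e by (simp add: norm_eq_1)
  have pe: "p \<bullet> e = 0" "e \<bullet> p = 0"
    using ee by (simp_all add: p_def inner_simps inner_commute)
  have A: "0 \<le> A" by (simp add: A_def)
  have C: "0 \<le> C" using A by (simp add: C_def)
  have \<eta>: "0 < \<eta>" using \<epsilon> by (simp add: \<eta>_def)
  \<comment> \<open>The projection \<open>p\<close> of \<open>x\<close> has to lie in the ball of
    radius \<open>R\<close> for \<open>body_quad_le\<close>.\<close>
  have "x \<in> closure (\<Union>m\<in>{0..}. body m K)"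
    using x unfolding limit_body_def by blast
  also have "\<dots> \<subseteq> cball 0 R"
    using body_in_cball[OF R] by (intro closure_minimal) auto
  finally have "norm x \<le> R" by simp
  moreover have "norm p \<le> norm x"
  proof -
    have "(norm x)\<^sup>2 = (norm p)\<^sup>2 + (x \<bullet> e)\<^sup>2"
    proof -
      have "x = p + (x \<bullet> e) *\<^sub>R e" by (simp add: p_def)
      then have "x \<bullet> x = (p + (x \<bullet> e) *\<^sub>R e) \<bullet> (p + (x \<bullet> e) *\<^sub>R e)" by simp
      then show ?thesis
        unfolding power2_norm_eq_inner
        by (simp add: inner_add_left inner_add_right pe ee power2_eq_square[of "x \<bullet> e"])
    qed
    then have "(norm p)\<^sup>2 \<le> (norm x)\<^sup>2"
      using zero_le_power2[of "x \<bullet> e"] by linarith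
    then show ?thesis
      by (rule power2_le_imp_le) (rule norm_ge_zero)
  qed
  ultimately have p: "norm p \<le> R" by linarith
  \<comment> \<open>The remaining error is then at most \<open>\<eta> / 2\<close>;
    \<open>C + 1\<close> avoids division by zero.\<close>
  obtain N where N: "1 \<le> N" "\<And>m n. N \<le> m \<Longrightarrow> (\<Sum>i = m..<n. 1 - (e \<bullet> v i)\<^sup>2) < \<eta> / (2 * (C + 1))"
    using tail_sum_small[of "\<eta> / (2 * (C + 1))"] \<eta> C by auto
  obtain m where m: "N \<le> m" "\<not> (\<exists>z\<in>body m K. dist z x < \<epsilon>)"
    using contra unfolding eventually_sequentially by blast
  have gap: "quad e A p z \<le> (x \<bullet> e)\<^sup>2 - \<eta>" if "z \<in> body m K" for z
    unfolding A_def p_def \<eta>_def using m N(1) by (intro quad_le_of_gap[OF _ R \<epsilon> _ that]) force+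
  have "quad e A p z \<le> (x \<bullet> e)\<^sup>2 - \<eta> / 2" if "z \<in> body n K" "m \<le> n" for z n
  proof -
    have "quad e A p z \<le> (x \<bullet> e)\<^sup>2 - \<eta> + C * (\<Sum>i = m..<n. 1 - (e \<bullet> v i)\<^sup>2)"
      unfolding C_def by (rule body_quad_le[OF R pe(1) p A gap that(2,1)])
    also have "C * (\<Sum>i = m..<n. 1 - (e \<bullet> v i)\<^sup>2) \<le> C * (\<eta> / (2 * (C + 1)))"
      using N(2)[OF m(1), of n] C by (intro mult_left_mono) auto
    also have "\<dots> \<le> \<eta> / 2"
      using C \<eta> by (simp add: divide_simps)
    finally show ?thesis by simp
  qed
  then have "(\<Union>n\<in>{m..}. body n K) \<subseteq> {z. quad e A p z \<le> (x \<bullet> e)\<^sup>2 - \<eta> / 2}"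
    by auto
  moreover have "closed {z. quad e A p z \<le> (x \<bullet> e)\<^sup>2 - \<eta> / 2}"
    unfolding quad_def by (intro closed_Collect_le continuous_intros)
  ultimately have "closure (\<Union>n\<in>{m..}. body n K) \<subseteq> {z. quad e A p z \<le> (x \<bullet> e)\<^sup>2 - \<eta> / 2}"
    by (rule closure_minimal)
  then have "quad e A p x \<le> (x \<bullet> e)\<^sup>2 - \<eta> / 2"
    using x unfolding limit_body_def by blast
  then show False
    using \<eta> by (simp add: quad_def p_def)
qed

text \<open>A finite net of radius \<open>\<delta> / 2\<close> in the compact limit body makes the
  pointwise approach uniform.\<close>

lemma eventually_limit_body_subset:
  assumes K: "compact K" and \<delta>: "0 < \<delta>"
  shows "\<forall>\<^sub>F m in sequentially. limit_body K \<subseteq> outer_parallel \<delta> (body m K)"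
proof -
  have "limit_body K \<subseteq> (\<Union>x\<in>limit_body K. ball x (\<delta> / 2))"
    using \<delta> by auto
  then obtain F where F: "F \<subseteq> limit_body K" "finite F" "limit_body K \<subseteq> (\<Union>x\<in>F. ball x (\<delta> / 2))"
    using compactE_image[OF compact_limit_body[OF K], of "limit_body K" "\<lambda>x. ball x (\<delta> / 2)"] by auto
  have "\<forall>\<^sub>F m in sequentially. \<forall>x\<in>F. \<exists>z\<in>body m K. dist z x < \<delta> / 2"
    using F(1) \<delta> by (intro eventually_ball_finite[OF F(2)] ballI eventually_body_near[OF K]) auto
  then show ?thesis
  proof (rule eventually_mono)
    fix m assume *: "\<forall>x\<in>F. \<exists>z\<in>body m K. dist z x < \<delta> / 2"
    show "limit_body K \<subseteq> outer_parallel \<delta> (body m K)"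
    proof
      fix y assume "y \<in> limit_body K"
      then obtain x where "x \<in> F" "dist x y < \<delta> / 2"
        using F(3) by auto
      moreover obtain z where "z \<in> body m K" "dist z x < \<delta> / 2"
        using * \<open>x \<in> F\<close> by blast
      ultimately have "dist z y \<le> \<delta>"
        using dist_triangle[of z y x] by linarith
      then show "y \<in> outer_parallel \<delta> (body m K)"
        using \<open>z \<in> body m K\<close> by (auto simp: mem_outer_parallel)
    qed
  qed
qed

lemma hausdorff_dist_body_tendsto:
  assumes "compact K"
  shows "(\<lambda>m. hausdorff_dist (body m K) (limit_body K)) \<longlonglongrightarrow> 0"
proof (rule tendstoI)
  fix \<epsilon> :: real assume "0 < \<epsilon>"
  then have "0 < \<epsilon> / 2" by simp
  have "\<forall>\<^sub>F m in sequentially. body m K \<subseteq> outer_parallel (\<epsilon> / 2) (limit_body K) \<and>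
      limit_body K \<subseteq> outer_parallel (\<epsilon> / 2) (body m K)"
    by (intro eventually_conj eventually_body_subset eventually_limit_body_subset assms \<open>0 < \<epsilon> / 2\<close>)
  then show "\<forall>\<^sub>F m in sequentially. dist (hausdorff_dist (body m K) (limit_body K)) 0 < \<epsilon>"
  proof (rule eventually_mono)
    fix m
    let ?S = "{\<delta>. 0 < \<delta> \<and> body m K \<subseteq> outer_parallel \<delta> (limit_body K) \<and> limit_body K \<subseteq> outer_parallel \<delta> (body m K)}"
    assume "body m K \<subseteq> outer_parallel (\<epsilon> / 2) (limit_body K) \<and> limit_body K \<subseteq> outer_parallel (\<epsilon> / 2) (body m K)"
    then have mem: "\<epsilon> / 2 \<in> ?S"
      using \<open>0 < \<epsilon> / 2\<close> by blast
    then have "Inf ?S \<le> \<epsilon> / 2"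
      by (rule cInf_lower) (auto intro!: bdd_belowI[of _ 0])
    moreover have "0 \<le> Inf ?S"
      using mem by (intro cInf_greatest) auto
    ultimately show "dist (hausdorff_dist (body m K) (limit_body K)) 0 < \<epsilon>"
      using \<open>0 < \<epsilon>\<close> unfolding hausdorff_dist_def by simp
  qed
qed

section \<open>Volume of the limit\<close>

lemma measure_limit_body_le:
  assumes K: "compact K"
  shows "measure lebesgue (limit_body K) \<le> measure lebesgue K"
proof (rule LIMSEQ_le_const[OF measure_outer_parallel_tendsto[OF K]], intro exI allI impI)
  fix n :: nat
  let ?\<delta> = "inverse (real (Suc n))"
  \<comment> \<open>For each radius a single late body suffices: its parallel set covers the limit
    body and has at most the volume of the parallel set of \<open>K\<close>.\<close>
  have "\<forall>\<^sub>F m in sequentially. limit_body K \<subseteq> outer_parallel ?\<delta> (body m K)"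
    by (rule eventually_limit_body_subset[OF K]) simp
  then obtain m where "limit_body K \<subseteq> outer_parallel ?\<delta> (body m K)"
    unfolding eventually_sequentially by blast
  also have "\<dots> \<subseteq> body m (outer_parallel ?\<delta> K)"
    by (rule body_outer_parallel_subset[OF K])
  finally have "measure lebesgue (limit_body K) \<le> measure lebesgue (body m (outer_parallel ?\<delta> K))"
    by (intro measure_mono_fmeasurable fmeasurableD lmeasurable_compact compact_limit_body compact_body
        compact_outer_parallel K)
  also have "\<dots> = measure lebesgue (outer_parallel ?\<delta> K)"
    by (intro measure_body compact_outer_parallel K)
  finally show "measure lebesgue (limit_body K) \<le> measure lebesgue (outer_parallel ?\<delta> K)" .
qed

text \<open>The symmetric difference has twice the volume of the union minus the two volumes. The
  union lies in a thin parallel set of the limit body, and the bodies have at least the volume of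
  the limit body.\<close>

lemma measure_sym_diff_body_tendsto:
  assumes K: "compact K"
  shows "(\<lambda>m. measure lebesgue (sym_diff (body m K) (limit_body K))) \<longlonglongrightarrow> 0"
proof (rule tendstoI)
  fix \<epsilon> :: real assume "0 < \<epsilon>"
  let ?L = "limit_body K" and ?\<mu> = "measure lebesgue"
  have L: "?L \<in> lmeasurable"
    by (intro lmeasurable_compact compact_limit_body K)
  have "\<forall>\<^sub>F n in sequentially. dist (?\<mu> (outer_parallel (inverse (real (Suc n))) ?L)) (?\<mu> ?L) < \<epsilon> / 2"
    using measure_outer_parallel_tendsto[OF compact_limit_body[OF K]] \<open>0 < \<epsilon>\<close>
    by (intro tendstoD) auto
  then obtain n where n: "dist (?\<mu> (outer_parallel (inverse (real (Suc n))) ?L)) (?\<mu> ?L) < \<epsilon> / 2"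
    unfolding eventually_sequentially by blast
  define \<delta> where "\<delta> = inverse (real (Suc n))"
  have "\<forall>\<^sub>F m in sequentially. body m K \<subseteq> outer_parallel \<delta> ?L"
    by (rule eventually_body_subset[OF K]) (simp add: \<delta>_def)
  then show "\<forall>\<^sub>F m in sequentially. dist (?\<mu> (sym_diff (body m K) ?L)) 0 < \<epsilon>"
  proof (rule eventually_mono)
    fix m assume sub: "body m K \<subseteq> outer_parallel \<delta> ?L"
    let ?B = "body m K"
    have B: "?B \<in> lmeasurable"
      by (intro lmeasurable_compact compact_body K)
    have "?\<mu> (?B \<union> ?L) \<le> ?\<mu> (outer_parallel \<delta> ?L)"
      using sub B L outer_parallel_superset[of \<delta> ?L]
      by (intro measure_mono_fmeasurable)
         (auto simp: \<delta>_def fmeasurableD intro!: lmeasurable_compact compact_outer_parallel compact_limit_body K)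
    moreover have "?\<mu> (outer_parallel \<delta> ?L) < ?\<mu> ?L + \<epsilon> / 2"
      using n unfolding \<delta>_def dist_real_def by linarith
    moreover have "?\<mu> (sym_diff ?B ?L) = ?\<mu> (?B - ?L) + ?\<mu> (?L - ?B)"
    proof -
      have "(?B - ?L) \<inter> (?L - ?B) = {}" by blast
      then show ?thesis
        using B L by (simp add: measure_Un3 fmeasurable.Diff)
    qed
    moreover have "?\<mu> (?B \<union> ?L) = ?\<mu> ?B + ?\<mu> (?L - ?B)" "?\<mu> (?B \<union> ?L) = ?\<mu> ?L + ?\<mu> (?B - ?L)"
      using measure_Un2[OF B L] measure_Un2[OF L B] by (simp_all add: Un_commute)
    moreover have "?\<mu> ?L \<le> ?\<mu> ?B"
      using measure_limit_body_le[OF K] measure_body[OF K] by simp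
    ultimately have "?\<mu> (sym_diff ?B ?L) < \<epsilon>"
      by linarith
    then show "dist (?\<mu> (sym_diff ?B ?L)) 0 < \<epsilon>"
      by simp
  qed
qed

end

section \<open>The rotations\<close>

text \<open>After rescaling \<open>b\<close> to the length of \<open>a\<close>, an orthogonal map
  takes one vector to the other and conjugates the reflections; its determinant cancels.\<close>

lemma det_matrix_hrefl_eq:
  fixes a b :: "real ^ 'n"
  assumes "a \<noteq> 0" "b \<noteq> 0"
  shows "det (matrix (hrefl a)) = det (matrix (hrefl b))"
proof -
  define b' where "b' = (norm a / norm b) *\<^sub>R b"
  have b': "norm a = norm b'" "hrefl b' = hrefl b"
    using assms by (simp_all add: b'_def hrefl_scaleR)
  obtain f where f: "orthogonal_transformation f" "f a = b'"
    using orthogonal_transformation_exists[OF b'(1)] by blast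
  have lin: "linear f" "linear (hrefl a)" "linear (hrefl b')"
    using f(1) orthogonal_hrefl[of a] orthogonal_hrefl[of b'] by (simp_all add: orthogonal_transformation_def)
  have "hrefl b' \<circ> f = f \<circ> hrefl a"
    using hrefl_orthogonal[OF f(1), of a] f(2) by (auto simp: fun_eq_iff)
  then have "matrix (hrefl b') ** matrix f = matrix f ** matrix (hrefl a)"
    using lin by (metis matrix_compose)
  then have "det (matrix (hrefl b')) * det (matrix f) = det (matrix f) * det (matrix (hrefl a))"
    by (metis det_mul)
  moreover have "det (matrix f) \<noteq> 0"
    using f(1) det_orthogonal_matrix[of "matrix f"] by (auto simp: orthogonal_transformation_matrix)
  ultimately show ?thesis
    by (simp add: b'(2))
qed

text \<open>Both reflections have the same determinant \<open>\<plusminus> 1\<close>.\<close>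
lemma rotation_matrix_turn:
  fixes v e :: "real ^ 'n"
  assumes "v \<noteq> 0" "e + v \<noteq> 0"
  shows "rotation_matrix (matrix (turn v e))"
proof -
  have lin: "linear (hrefl v)" "linear (hrefl (e + v))"
    using orthogonal_hrefl[of v] orthogonal_hrefl[of "e + v"] by (simp_all add: orthogonal_transformation_def)
  have "det (matrix (hrefl v)) = 1 \<or> det (matrix (hrefl v)) = - 1"
    using orthogonal_hrefl[of v] by (intro det_orthogonal_matrix) (simp add: orthogonal_transformation_matrix)
  moreover have "det (matrix (turn v e)) = det (matrix (hrefl v)) * det (matrix (hrefl v))"
    unfolding turn_def using lin det_matrix_hrefl_eq[OF assms]
    by (simp add: matrix_compose det_mul)
  ultimately have "det (matrix (turn v e)) = 1"
    by auto
  then show ?thesis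
    using orthogonal_turn[of v e] by (simp add: rotation_matrix_def orthogonal_transformation_matrix)
qed

text \<open>\<open>frame u m\<close> is the rotation applied after \<open>m\<close> symmetrizations.
  The next direction, seen in the current frame, is turned to \<open>u 1\<close>; the first turn
  takes \<open>u 1\<close> to itself.\<close>

primrec frame :: "(nat \<Rightarrow> real ^ 'n) \<Rightarrow> nat \<Rightarrow> real ^ 'n ^ 'n" where
  "frame u 0 = mat 1"
| "frame u (Suc m) = matrix (turn (frame u m *v u (Suc m)) (u 1)) ** frame u m"

declare frame.simps(2) [simp del]

context
  fixes \<alpha> :: "nat \<Rightarrow> real" and u :: "nat \<Rightarrow> real ^ 'n"
  assumes angle: "\<And>m. m \<ge> 1 \<Longrightarrow> 0 < \<alpha> m \<and> \<alpha> m < pi / 2"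
    and summable_angle: "summable (\<lambda>m. (\<alpha> (Suc m))\<^sup>2)"
    and norm_u: "\<And>m. m \<ge> 1 \<Longrightarrow> norm (u m) = 1"
    and inner_u: "\<And>m. m \<ge> 1 \<Longrightarrow> u m \<bullet> u (Suc m) = cos (\<alpha> (Suc m))"
begin

lemma frame_Suc_apply:
  "frame u (Suc m) *v x = turn (frame u m *v u (Suc m)) (u 1) (frame u m *v x)"
proof -
  have "linear (turn (frame u m *v u (Suc m)) (u 1))"
    using orthogonal_turn[of "frame u m *v u (Suc m)" "u 1"] by (simp add: orthogonal_transformation_def)
  then show ?thesis
    by (simp add: frame.simps(2) matrix_works flip: matrix_vector_mul_assoc)
qed

lemma orthogonal_frame: "orthogonal_transformation ((*v) (frame u m))"
proof (induction m)
  case 0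
  then show ?case by (simp add: orthogonal_transformation_def)
next
  case (Suc m)
  have "(*v) (frame u (Suc m)) = turn (frame u m *v u (Suc m)) (u 1) \<circ> (*v) (frame u m)"
    by (simp only: fun_eq_iff frame_Suc_apply comp_def) simp
  then show ?case
    by (simp only: orthogonal_transformation_compose[OF orthogonal_turn Suc])
qed

lemma norm_frame: "norm (frame u m *v u (Suc m)) = 1"
  using orthogonal_transformation_norm[OF orthogonal_frame] norm_u by simp

text \<open>The two claims need a joint induction: the first gives the inner product at the next
  index, whose positivity rules out \<open>- 1\<close> and lets \<open>turn_apply\<close> give the
  first claim there.\<close>

lemma frame_apply_and_inner:
  "frame u (Suc m) *v u (Suc m) = u 1 \<and>
   u 1 \<bullet> (frame u m *v u (Suc m)) = (if m = 0 then 1 else cos (\<alpha> (Suc m)))"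
proof (induction m)
  case 0
  have "u 1 \<bullet> u 1 = 1"
    using norm_u[of 1] by (simp add: norm_eq_1)
  moreover have "frame u (Suc 0) *v u (Suc 0) = u 1"
    using turn_apply[of "u 1" "u 1"] norm_u[of 1] \<open>u 1 \<bullet> u 1 = 1\<close>
    by (simp add: frame_Suc_apply)
  ultimately show ?case by simp
next
  case (Suc m)
  have "(frame u (Suc m) *v u (Suc m)) \<bullet> (frame u (Suc m) *v u (Suc (Suc m))) =
      u (Suc m) \<bullet> u (Suc (Suc m))"
    using orthogonal_frame[of "Suc m"] by (simp only: orthogonal_transformation_def)
  then have "u 1 \<bullet> (frame u (Suc m) *v u (Suc (Suc m))) = u (Suc m) \<bullet> u (Suc (Suc m))"
    by (simp only: conjunct1[OF Suc])
  then have inner: "u 1 \<bullet> (frame u (Suc m) *v u (Suc (Suc m))) = cos (\<alpha> (Suc (Suc m)))"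
    by (simp add: inner_u)
  moreover have "cos (\<alpha> (Suc (Suc m))) > 0"
    using angle[of "Suc (Suc m)"] by (intro cos_gt_zero) auto
  ultimately have "frame u (Suc (Suc m)) *v u (Suc (Suc m)) = u 1"
    unfolding frame_Suc_apply[of "Suc m"] using norm_u[of 1] norm_frame[of "Suc m"]
    by (intro turn_apply) auto
  with inner show ?case by simp
qed

lemma frame_inner_pos: "0 < u 1 \<bullet> (frame u m *v u (Suc m))"
  using frame_apply_and_inner[of m] angle[of "Suc m"] by (auto intro!: cos_gt_zero)

lemma rotation_matrix_frame: "rotation_matrix (frame u m)"
proof (induction m)
  case 0
  then show ?case by (simp add: rotation_matrix_def orthogonal_matrix_id)
next
  case (Suc m)
  let ?v = "frame u m *v u (Suc m)"
  have "?v \<noteq> 0"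
    using norm_frame[of m] by auto
  moreover have "u 1 + ?v \<noteq> 0"
  proof
    assume "u 1 + ?v = 0"
    then have "?v = - u 1" by (simp add: eq_neg_iff_add_eq_0 add.commute)
    then show False
      using frame_inner_pos[of m] inner_ge_zero[of "u 1"] by (simp only: inner_minus_right)
  qed
  ultimately have "rotation_matrix (matrix (turn ?v (u 1)))"
    by (rule rotation_matrix_turn)
  with Suc show ?case
    by (simp add: frame.simps(2) rotation_matrix_def orthogonal_matrix_mul det_mul)
qed

text \<open>Moving the rotation inside the last symmetrization sends its direction to
  \<open>u 1\<close>; the rotation then splits into the last turn and the previous frame.\<close>

lemma frame_image_iterated_steiner:
  "(*v) (frame u m) ` iterated_steiner u m K = turned_steiner (u 1) (\<lambda>m. frame u m *v u (Suc m)) m K"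
proof (induction m)
  case 0
  then show ?case by simp
next
  case (Suc m)
  let ?J = "iterated_steiner u m K" and ?T = "turn (frame u m *v u (Suc m)) (u 1)"
  have "(*v) (frame u (Suc m)) ` iterated_steiner u (Suc m) K =
      steiner_symmetral (frame u (Suc m) *v u (Suc m)) ((*v) (frame u (Suc m)) ` ?J)"
    using steiner_image_orthogonal[OF orthogonal_frame[of "Suc m"] norm_u[of "Suc m"]] by simp
  also have "(*v) (frame u (Suc m)) ` ?J = ?T ` (*v) (frame u m) ` ?J"
    unfolding image_image by (intro image_cong refl frame_Suc_apply)
  finally show ?case
    using frame_apply_and_inner[of m] Suc by simp
qed

lemma slow_turning_frame: "slow_turning (u 1) (\<lambda>m. frame u m *v u (Suc m))"
proof
  show "norm (u 1) = 1" by (simp add: norm_u)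
  show "norm (frame u m *v u (Suc m)) = 1" for m by (rule norm_frame)
  show "0 \<le> u 1 \<bullet> (frame u m *v u (Suc m))" for m
    using frame_inner_pos[of m] by simp
  show "summable (\<lambda>m. 1 - (u 1 \<bullet> (frame u m *v u (Suc m)))\<^sup>2)"
  proof (rule summable_comparison_test'[OF summable_angle])
    fix m
    \<comment> \<open>The terms are squared sines of the angles, except for \<open>m = 0\<close>,
      where the inner product is 1 and the term vanishes.\<close>
    have "\<bar>sin (\<alpha> (Suc m))\<bar> \<le> \<bar>\<alpha> (Suc m)\<bar>"
      by (rule abs_sin_x_le_abs_x)
    then have "(sin (\<alpha> (Suc m)))\<^sup>2 \<le> (\<alpha> (Suc m))\<^sup>2"
      by (simp add: abs_le_square_iff)
    then show "norm (1 - (u 1 \<bullet> (frame u m *v u (Suc m)))\<^sup>2) \<le> (\<alpha> (Suc m))\<^sup>2"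
      using frame_apply_and_inner[of m] by (auto simp flip: sin_squared_eq)
  qed
qed

end

theorem theorem2p2:
  fixes \<alpha> :: "nat \<Rightarrow> real" and u :: "nat \<Rightarrow> real ^ 'n"
  assumes "CARD('n) \<ge> 2"
    and "\<And>m. m \<ge> 1 \<Longrightarrow> 0 < \<alpha> m \<and> \<alpha> m < pi / 2"
    and "summable (\<lambda>m. (\<alpha> (Suc m))\<^sup>2)"
    and "\<And>m. m \<ge> 1 \<Longrightarrow> u m \<in> sphere 0 1"
    and "\<And>m. m \<ge> 2 \<Longrightarrow> u (m - 1) \<bullet> u m = cos (\<alpha> m)"
  shows "\<exists>R :: nat \<Rightarrow> real ^ 'n ^ 'n.
    (\<forall>m\<ge>1. rotation_matrix (R m)) \<and>
    (\<forall>K. compact K \<and> K \<noteq> {} \<longrightarrow>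
      (\<exists>L. compact L \<and> L \<noteq> {} \<and>
        (\<lambda>m. hausdorff_dist ((*v) (R m) ` iterated_steiner u m K) L) \<longlonglongrightarrow> 0 \<and>
        (\<lambda>m. measure lebesgue (sym_diff ((*v) (R m) ` iterated_steiner u m K) L)) \<longlonglongrightarrow> 0))"
proof -
  have norm_u: "norm (u m) = 1" if "m \<ge> 1" for m
    using assms(4)[OF that] by simp
  have inner_u: "u m \<bullet> u (Suc m) = cos (\<alpha> (Suc m))" if "m \<ge> 1" for m
    using assms(5)[of "Suc m"] that by simp
  note hyps = assms(2,3) norm_u inner_u
  interpret slow_turning "u 1" "\<lambda>m. frame u m *v u (Suc m)"
    using hyps by (rule slow_turning_frame)
  have image: "(*v) (frame u m) ` iterated_steiner u m K = body m K" for m K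
    using hyps by (rule frame_image_iterated_steiner)
  \<comment> \<open>\<open>frame u\<close> is fixed before \<open>K\<close> enters, which makes the
    rotations independent of \<open>K\<close>.\<close>
  show ?thesis
  proof (intro exI[of _ "frame u"] conjI allI impI)
    show "rotation_matrix (frame u m)" for m
      using hyps by (rule rotation_matrix_frame)
    fix K :: "(real ^ 'n) set" assume "compact K \<and> K \<noteq> {}"
    then show "\<exists>L. compact L \<and> L \<noteq> {} \<and>
        (\<lambda>m. hausdorff_dist ((*v) (frame u m) ` iterated_steiner u m K) L) \<longlonglongrightarrow> 0 \<and>
        (\<lambda>m. measure lebesgue (sym_diff ((*v) (frame u m) ` iterated_steiner u m K) L)) \<longlonglongrightarrow> 0"
      unfolding image
      by (intro exI[of _ "limit_body K"] conjI compact_limit_body limit_body_nonempty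
          hausdorff_dist_body_tendsto measure_sym_diff_body_tendsto) auto
  qed
qed

end
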